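(* Let $s\geq 2$ and $t\geq 1$ be integers and let $\Gamma$ be a co-edge-regular graph with spectrum $$\{\big(s(2t+1)-1\big)^{1},\ (st-1)^{2t},\ (-1)^{(s-1)(t+1)^{2}},\ (-s-1)^{t^2}\}$$ (exponents denote multiplicities). If $t\geq 11(s+1)^3(s+2)$, then $\Gamma$ is (isomorphic to) the $s$-clique extension of the $(t+1)\times(t+1)$-grid.
   Context: Graphs are finite and simple; the spectrum of a graph is the multiset of eigenvalues of its adjacency matrix. A graph is co-edge-regular if it is regular and there is a constant $\mu$ such that any two distinct nonadjacent vertices have exactly $\mu$ common neighbours. The $n\times n$-grid is the Cartesian product $K_n\Box K_n$. For a positive integer $s$, the $s$-clique extension of a graph $G$ is the graph obtained from $G$ by replacing each vertex $x$ by a clique $\widetilde X$ on $s$ vertices, where $\tilde x\in\widetilde X$ and $\tilde y\in \widetilde Y$ (for distinct vertices $x,y$) are adjacent if and only if $x\sim y$ in $G$ (and vertices within the same $\widetilde X$ are all adjacent). *)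

theory Defs
  imports
    "Graph_Theory.Graph_Theory"
    "Jordan_Normal_Form.Char_Poly"
begin

text \<open>
  A finite simple graph is an instance of the locale \<^locale>\<open>graph\<close>: a finite, loop-free
  digraph without parallel arcs whose adjacency relation is symmetric.  Each edge is
  represented by its two arcs, so the degree of a vertex is its \<^const>\<open>out_degree\<close>.
\<close>

definition adjacency_matrix :: "('a, 'b) pre_digraph \<Rightarrow> 'a list \<Rightarrow> complex mat" where
  "adjacency_matrix G vs =
    mat (length vs) (length vs) (\<lambda>(i, j). if vs ! i \<rightarrow>\<^bsub>G\<^esub> vs ! j then 1 else 0)"

text \<open>
  Eigenvalues are counted with algebraic multiplicity over \<^typ>\<open>complex\<close>, so that none can be
  missed; as the matrix is real symmetric they are all real and algebraic and geometric
  multiplicities agree.  The choice of the enumeration of the vertices is immaterial, see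
  \<open>graph_spectrum_eq\<close> below.
\<close>

definition graph_spectrum :: "('a, 'b) pre_digraph \<Rightarrow> complex multiset" where
  "graph_spectrum G =
    proots (char_poly (adjacency_matrix G (SOME vs. distinct vs \<and> set vs = verts G)))"

definition regular_graph :: "('a, 'b) pre_digraph \<Rightarrow> bool" where
  "regular_graph G \<longleftrightarrow> (\<exists>k. \<forall>v \<in> verts G. out_degree G v = k)"

definition common_neighbours :: "('a, 'b) pre_digraph \<Rightarrow> 'a \<Rightarrow> 'a \<Rightarrow> 'a set" where
  "common_neighbours G u v = {w \<in> verts G. u \<rightarrow>\<^bsub>G\<^esub> w \<and> v \<rightarrow>\<^bsub>G\<^esub> w}"

definition co_edge_regular :: "('a, 'b) pre_digraph \<Rightarrow> bool" where
  "co_edge_regular G \<longleftrightarrow> regular_graph G \<and>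
    (\<exists>\<mu>. \<forall>u \<in> verts G. \<forall>v \<in> verts G.
      u \<noteq> v \<longrightarrow> \<not> u \<rightarrow>\<^bsub>G\<^esub> v \<longrightarrow> card (common_neighbours G u v) = \<mu>)"

definition complete_graph :: "nat \<Rightarrow> nat pair_pre_digraph" where
  "complete_graph n =
    \<lparr>pverts = {..<n}, parcs = {(i, j). i < n \<and> j < n \<and> i \<noteq> j}\<rparr>"

definition cartesian_product ::
    "('a, 'b) pre_digraph \<Rightarrow> ('c, 'd) pre_digraph \<Rightarrow> ('a \<times> 'c) pair_pre_digraph" where
  "cartesian_product G H =
    \<lparr>pverts = verts G \<times> verts H,
     parcs = {((x, y), (x', y')).
       x \<in> verts G \<and> x' \<in> verts G \<and> y \<in> verts H \<and> y' \<in> verts H \<and>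
       (x = x' \<and> y \<rightarrow>\<^bsub>H\<^esub> y' \<or> x \<rightarrow>\<^bsub>G\<^esub> x' \<and> y = y')}\<rparr>"

definition grid_graph :: "nat \<Rightarrow> (nat \<times> nat) pair_pre_digraph" where
  "grid_graph n = cartesian_product (complete_graph n) (complete_graph n)"

text \<open>The clique replacing the vertex \<open>x\<close> is \<open>{x} \<times> {..<s}\<close>.\<close>

definition clique_extension ::
    "nat \<Rightarrow> ('a, 'b) pre_digraph \<Rightarrow> ('a \<times> nat) pair_pre_digraph" where
  "clique_extension s G =
    \<lparr>pverts = verts G \<times> {..<s},
     parcs = {((x, i), (y, j)).
       x \<in> verts G \<and> y \<in> verts G \<and> i < s \<and> j < s \<and>
       (x = y \<and> i \<noteq> j \<or> x \<noteq> y \<and> x \<rightarrow>\<^bsub>G\<^esub> y)}\<rparr>"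

lemma adjacency_matrix_similar:
  assumes "distinct vs" "distinct ws" "set vs = set ws"
  shows "similar_mat (adjacency_matrix G vs) (adjacency_matrix G ws)"
proof -
  define n where "n = length vs"
  have len: "length ws = n"
    using assms by (metis distinct_card n_def)
  define P :: "complex mat" where
    "P = mat n n (\<lambda>(i, j). if vs ! i = ws ! j then 1 else 0)"
  define Q :: "complex mat" where
    "Q = mat n n (\<lambda>(i, j). if ws ! i = vs ! j then 1 else 0)"
  have "\<exists>j. j < n \<and> ws ! j = vs ! i" if "i < n" for i
  proof -
    have "vs ! i \<in> set ws"
      using that assms(3) len n_def by (metis nth_mem)
    then show ?thesis using len by (auto simp: in_set_conv_nth n_def)
  qed
  then obtain f where f: "\<And>i. i < n \<Longrightarrow> f i < n \<and> ws ! f i = vs ! i" by metis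
  have "\<exists>j. j < n \<and> vs ! j = ws ! i" if "i < n" for i
  proof -
    have "ws ! i \<in> set vs"
      using that assms(3) len n_def by (metis nth_mem)
    then show ?thesis using len by (auto simp: in_set_conv_nth n_def)
  qed
  then obtain g where g: "\<And>i. i < n \<Longrightarrow> g i < n \<and> vs ! g i = ws ! i" by metis
  have eqv: "vs ! i = vs ! j \<longleftrightarrow> i = j" if "i < n" "j < n" for i j
    using assms that by (simp add: n_def nth_eq_iff_index_eq)
  have eqw: "ws ! i = ws ! j \<longleftrightarrow> i = j" if "i < n" "j < n" for i j
    using assms that len by (simp add: nth_eq_iff_index_eq)
  have Pf: "P $$ (i, k) = (if k = f i then 1 else 0)" if "i < n" "k < n" for i k
    using that f[OF that(1)] eqw[of "f i" k] unfolding P_def by auto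
  have Qf: "Q $$ (k, j) = (if k = f j then 1 else 0)" if "j < n" "k < n" for j k
    using that f[OF that(1)] eqw[of k "f j"] unfolding Q_def by auto
  have Qg: "Q $$ (i, k) = (if k = g i then 1 else 0)" if "i < n" "k < n" for i k
    using that g[OF that(1)] eqv[of "g i" k] unfolding Q_def by auto
  have cP: "P \<in> carrier_mat n n" and cQ: "Q \<in> carrier_mat n n"
    by (auto simp: P_def Q_def)
  have cA: "adjacency_matrix G vs \<in> carrier_mat n n"
    and cB: "adjacency_matrix G ws \<in> carrier_mat n n"
    by (auto simp: adjacency_matrix_def n_def len)
  have mult: "(X * Y) $$ (i, j) = (\<Sum>k<n. X $$ (i, k) * Y $$ (k, j))"
    if "X \<in> carrier_mat n n" "Y \<in> carrier_mat n n" "i < n" "j < n"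
    for X Y :: "complex mat" and i j
    using that by (auto simp: scalar_prod_def atLeast0LessThan)
  have left: "(P * X) $$ (i, j) = X $$ (f i, j)"
    if "X \<in> carrier_mat n n" "i < n" "j < n" for X i j
    using that f[OF that(2)] by (simp add: mult[OF cP] Pf if_distrib if_distribR cong: if_cong)
  have right: "(X * Q) $$ (i, j) = X $$ (i, f j)"
    if "X \<in> carrier_mat n n" "i < n" "j < n" for X i j
    using that f[OF that(3)] by (simp add: mult[OF _ cQ] Qf if_distrib if_distribR cong: if_cong)
  have left': "(Q * X) $$ (i, j) = X $$ (g i, j)"
    if "X \<in> carrier_mat n n" "i < n" "j < n" for X i j
    using that g[OF that(2)] by (simp add: mult[OF cQ] Qg if_distrib if_distribR cong: if_cong)
  have "P * Q = 1\<^sub>m n"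
  proof (rule eq_matI)
    fix i j assume "i < dim_row (1\<^sub>m n :: complex mat)" "j < dim_col (1\<^sub>m n :: complex mat)"
    then have ij: "i < n" "j < n" by auto
    show "(P * Q) $$ (i, j) = 1\<^sub>m n $$ (i, j)"
      unfolding left[OF cQ ij]
      using ij f[OF ij(1)] eqv[OF ij] by (simp add: Q_def)
  qed (use cP cQ in auto)
  moreover have "Q * P = 1\<^sub>m n"
  proof (rule eq_matI)
    fix i j assume "i < dim_row (1\<^sub>m n :: complex mat)" "j < dim_col (1\<^sub>m n :: complex mat)"
    then have ij: "i < n" "j < n" by auto
    show "(Q * P) $$ (i, j) = 1\<^sub>m n $$ (i, j)"
      unfolding left'[OF cP ij]
      using ij g[OF ij(1)] eqw[OF ij] by (simp add: P_def)
  qed (use cP cQ in auto)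
  moreover have "adjacency_matrix G vs = P * adjacency_matrix G ws * Q"
  proof (rule eq_matI)
    fix i j
    assume "i < dim_row (P * adjacency_matrix G ws * Q)"
      "j < dim_col (P * adjacency_matrix G ws * Q)"
    then have "i < n" "j < n" using cP cQ by auto
    then show "adjacency_matrix G vs $$ (i, j) = (P * adjacency_matrix G ws * Q) $$ (i, j)"
      using f by (simp add: right[OF mult_carrier_mat[OF cP cB]] left[OF cB])
        (simp add: adjacency_matrix_def n_def[symmetric] len)
  qed (use cA cP cQ in auto)
  ultimately show ?thesis
    using cA cB cP cQ by (intro similar_matI[of _ _ P Q n]) auto
qed

lemma graph_spectrum_eq:
  assumes "distinct vs" "set vs = verts G"
  shows "graph_spectrum G = proots (char_poly (adjacency_matrix G vs))"
proof -
  let ?ws = "SOME vs. distinct vs \<and> set vs = verts G"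
  have "distinct ?ws \<and> set ?ws = verts G"
    by (rule someI[of _ vs]) (use assms in auto)
  then have "similar_mat (adjacency_matrix G ?ws) (adjacency_matrix G vs)"
    using assms by (intro adjacency_matrix_similar) auto
  then show ?thesis
    unfolding graph_spectrum_def by (simp add: char_poly_similar)
qed

lemma complete_graph_correct: "K\<^bsub>n\<^esub> (with_proj (complete_graph n))"
  unfolding complete_digraph_pair_def by (auto simp: complete_graph_def)

lemma graph_cartesian_product:
  assumes "graph G" "graph H"
  shows "graph (with_proj (cartesian_product G H))"
proof -
  interpret G: graph G by fact
  interpret H: graph H by fact
  let ?C = "cartesian_product G H"
  have sub: "parcs ?C \<subseteq> pverts ?C \<times> pverts ?C"
    by (auto simp: cartesian_product_def)
  have fin: "finite (pverts ?C)"
    by (simp add: cartesian_product_def)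
  have "pair_graph ?C"
  proof
    show "finite (parcs ?C)"
      using sub fin by (meson finite_SigmaI finite_subset)
    show "symmetric (with_proj ?C)"
      unfolding symmetric_def
      by (auto simp: sym_def cartesian_product_def G.graph_symmetric H.graph_symmetric)
  qed (use fin in \<open>auto simp: cartesian_product_def dest: G.adj_not_same H.adj_not_same\<close>)
  then show ?thesis by (rule pair_graph.pair_graphD_graph)
qed

lemma graph_clique_extension:
  assumes "graph G"
  shows "graph (with_proj (clique_extension s G))"
proof -
  interpret G: graph G by fact
  let ?C = "clique_extension s G"
  have sub: "parcs ?C \<subseteq> pverts ?C \<times> pverts ?C"
    by (auto simp: clique_extension_def)
  have fin: "finite (pverts ?C)"
    by (simp add: clique_extension_def)
  have "pair_graph ?C"
  proof
    show "finite (parcs ?C)"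
      using sub fin by (meson finite_SigmaI finite_subset)
    show "symmetric (with_proj ?C)"
      unfolding symmetric_def
      by (auto simp: sym_def clique_extension_def G.graph_symmetric)
  qed (use fin in \<open>auto simp: clique_extension_def\<close>)
  then show ?thesis by (rule pair_graph.pair_graphD_graph)
qed

end

theory Submission
  imports Defs "HOL-Analysis.Convex" "Jordan_Normal_Form.Schur_Decomposition"
begin

text \<open>
  Put \<open>B = A + I\<close>. The traces of powers of \<open>B\<close> determine the degree, the number \<open>\<mu> = 2s\<close> of common
  neighbours of nonadjacent vertices, and the identity \<open>B(B - st)(B + s) = 2s\<^sup>2(2t + 1)J\<close>. The matrix
  \<open>E = (B\<^sup>2 - s(t - 1)B - 2sJ) / (st)\<close> then satisfies \<open>E\<^sup>2 = sE\<close> and \<open>BE = sB\<close>, has unit diagonal and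
  vanishes on nonadjacent pairs, and on an edge \<open>xy\<close> it measures how far the number of common
  neighbours of \<open>x\<close> and \<open>y\<close> is from the value expected for two points of a line of the grid. Each row
  of \<open>E\<close> has squared norm \<open>s\<close>, so \<open>E\<close> is small on almost all edges at \<open>x\<close>, and as \<open>\<mu>\<close> is small this
  forces the neighbourhood of \<open>x\<close> to be two large cliques up to \<open>O(s)\<close> exceptional vertices. An
  exceptional vertex adjacent to all of neither clique would have only \<open>O(s)\<close> common neighbours with
  \<open>x\<close>, whereas every edge lies in at least about \<open>s\<surd>(2t)\<close> triangles. Since cliques have at most
  \<open>s(t + 1)\<close> vertices, integrality of the row norm of \<open>E\<close> finally shows that the closed
  neighbourhood of \<open>x\<close> is the union of two cliques of size \<open>s(t + 1)\<close> meeting in \<open>s\<close> twins of \<open>x\<close>, with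
  no further edges between them. These cliques are the lines of a geometry without triangles, and
  they fall into the two parallel classes of a grid.
\<close>

section \<open>Traces of products of shifted matrices\<close>

lemma sum_diag_mult_commute:
  fixes A B :: "'a :: comm_semiring_0 mat"
  assumes "A \<in> carrier_mat n n" "B \<in> carrier_mat n n"
  shows "(\<Sum>i<n. (A * B) $$ (i, i)) = (\<Sum>i<n. (B * A) $$ (i, i))"
proof -
  have *: "(X * Y) $$ (i, i) = (\<Sum>j<n. X $$ (i, j) * Y $$ (j, i))"
    if "X \<in> carrier_mat n n" "Y \<in> carrier_mat n n" "i < n" for X Y :: "'a mat" and i
    using that by (simp add: scalar_prod_def atLeast0LessThan)
  have "(\<Sum>i<n. (A * B) $$ (i, i)) = (\<Sum>i<n. \<Sum>j<n. A $$ (i, j) * B $$ (j, i))"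
    using assms by (intro sum.cong refl *) auto
  also have "\<dots> = (\<Sum>j<n. \<Sum>i<n. B $$ (j, i) * A $$ (i, j))"
    by (subst sum.swap) (simp add: mult.commute)
  also have "\<dots> = (\<Sum>i<n. (B * A) $$ (i, i))"
    using assms by (intro sum.cong refl *[symmetric]) auto
  finally show ?thesis .
qed

lemma upper_triangular_mult:
  fixes A B :: "'a :: semiring_0 mat"
  assumes A: "A \<in> carrier_mat n n" "upper_triangular A"
    and B: "B \<in> carrier_mat n n" "upper_triangular B"
  shows "upper_triangular (A * B)"
    and "i < n \<Longrightarrow> (A * B) $$ (i, i) = A $$ (i, i) * B $$ (i, i)"
proof -
  have entry: "(A * B) $$ (i, j) = (\<Sum>k<n. A $$ (i, k) * B $$ (k, j))" if "i < n" "j < n" for i j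
    using that A B by (simp add: scalar_prod_def atLeast0LessThan)
  have zero: "A $$ (i, k) * B $$ (k, j) = 0" if "i < n" "k < n" "k < i \<or> j < k" for i j k
    using that upper_triangularD[OF A(2), of k i] upper_triangularD[OF B(2), of j k] A B by auto
  show "upper_triangular (A * B)"
  proof
    fix i j assume ij: "j < i" "i < dim_row (A * B)"
    then have "i < n" "j < n" using A by auto
    then show "(A * B) $$ (i, j) = 0"
      unfolding entry[OF \<open>i < n\<close> \<open>j < n\<close>] using ij by (intro sum.neutral) (auto intro!: zero)
  qed
  assume i: "i < n"
  have "(\<Sum>k<n. A $$ (i, k) * B $$ (k, i)) = (\<Sum>k\<in>{i}. A $$ (i, k) * B $$ (k, i))"
    using i by (intro sum.mono_neutral_right) (auto intro!: zero)
  then show "(A * B) $$ (i, i) = A $$ (i, i) * B $$ (i, i)" using entry[OF i i] by simp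
qed

text \<open>\<^term>\<open>shifted_product V M as\<close> is the matrix product of the \<open>M - a I\<close> for \<open>a\<close> in \<open>as\<close>, for
  matrices given as functions on \<open>V \<times> V\<close>.\<close>

fun shifted_product :: "'a set \<Rightarrow> ('a \<Rightarrow> 'a \<Rightarrow> real) \<Rightarrow> real list \<Rightarrow> 'a \<Rightarrow> 'a \<Rightarrow> real" where
  "shifted_product V M [] = (\<lambda>x y. of_bool (x = y))"
| "shifted_product V M (a # as) =
    (\<lambda>x y. \<Sum>z\<in>V. (M x z - a * of_bool (x = z)) * shifted_product V M as z y)"

definition function_mat :: "'a list \<Rightarrow> ('a \<Rightarrow> 'a \<Rightarrow> real) \<Rightarrow> complex mat" where
  "function_mat vs F = mat (length vs) (length vs) (\<lambda>(i, j). of_real (F (vs ! i) (vs ! j)))"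

lemma function_mat_carrier: "function_mat vs F \<in> carrier_mat (length vs) (length vs)"
  by (simp add: function_mat_def)

lemma sum_nth: "distinct vs \<Longrightarrow> (\<Sum>i<length vs. f (vs ! i)) = (\<Sum>x\<in>set vs. f x)"
  by (rule sum.reindex_bij_betw, rule bij_betw_nth) simp_all

lemma function_mat_mult:
  assumes "distinct vs"
  shows "function_mat vs (\<lambda>x y. \<Sum>z\<in>set vs. F x z * G z y) = function_mat vs F * function_mat vs G"
  by (rule eq_matI) (simp_all add: function_mat_def scalar_prod_def atLeast0LessThan sum_nth[OF assms, symmetric])

text \<open>Schur triangularisation \<open>A = P T Q\<close> puts the eigenvalues on the diagonal of
  \<open>T\<close>. A product of shifts of \<open>A\<close> is then conjugate to an upper triangular
  matrix whose diagonal carries the products of shifted eigenvalues, and conjugation preserves the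
  trace.\<close>

lemma trace_shifted_product:
  fixes M :: "'a \<Rightarrow> 'a \<Rightarrow> real" and R :: "real multiset"
  assumes vs: "distinct vs"
    and R: "proots (char_poly (function_mat vs M)) = image_mset of_real R"
  shows "(\<Sum>x\<in>set vs. shifted_product (set vs) M as x x) = (\<Sum>r\<in>#R. \<Prod>a\<leftarrow>as. (r - a))"
proof -
  define n where "n = length vs"
  define A where "A = function_mat vs M"
  have A: "A \<in> carrier_mat n n" unfolding A_def n_def by (rule function_mat_carrier)
  obtain es where es: "char_poly A = (\<Prod>e\<leftarrow>es. [:- e, 1:])"
    using char_poly_factorized[OF A] by blast
  \<comment> \<open>This identifies the list \<open>es\<close> of the Schur form with
    \<open>R\<close>, up to order.\<close>
  have "proots (\<Prod>e\<leftarrow>es. [:- e, 1:]) = mset es" for es :: "complex list"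
  proof (induction es)
    case (Cons e es)
    have "(\<Prod>e\<leftarrow>es. [:- e, 1:]) \<noteq> 0" by (auto simp: prod_list_zero_iff)
    then have "proots ([:- e, 1:] * (\<Prod>e\<leftarrow>es. [:- e, 1:])) = proots [:- e, 1:] + mset es"
      using Cons by (subst proots_mult) auto
    also have "proots [:- e, 1:] = {#e#}" using proots_linear_factor[of "- e"] by simp
    finally show ?case by (simp del: mult_pCons_left)
  qed simp
  then have mset_es: "mset es = image_mset of_real R" using R es by (simp add: A_def)
  obtain T P Q where "schur_decomposition A es = (T, P, Q)" by (cases "schur_decomposition A es") auto
  then have wit: "similar_mat_wit A T P Q" and T: "upper_triangular T" "diag_mat T = es"
    using schur_decomposition[OF A es] by auto
  note w = similar_mat_witD2[OF A wit]
  have T_es: "map (\<lambda>i. T $$ (i, i)) [0..<n] = es" using T(2) w(5) by (simp add: diag_mat_def)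
  \<comment> \<open>The induction carries triangularity along with the diagonal, because only for
    triangular matrices is the diagonal of a product the product of the diagonals.\<close>
  have "\<exists>U \<in> carrier_mat n n. upper_triangular U \<and>
      (\<forall>i<n. U $$ (i, i) = (\<Prod>a\<leftarrow>as. (T $$ (i, i) - of_real a))) \<and>
      function_mat vs (shifted_product (set vs) M as) = P * U * Q"
  proof (induction as)
    case Nil
    have "function_mat vs (shifted_product (set vs) M []) = 1\<^sub>m n"
      using vs by (intro eq_matI) (auto simp: function_mat_def n_def nth_eq_iff_index_eq)
    then show ?case using w by (intro bexI[of _ "1\<^sub>m n"]) (auto simp del: shifted_product.simps)
  next
    case (Cons a as)
    then obtain U where U: "U \<in> carrier_mat n n" "upper_triangular U"
        "\<forall>i<n. U $$ (i, i) = (\<Prod>a\<leftarrow>as. (T $$ (i, i) - of_real a))"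
        "function_mat vs (shifted_product (set vs) M as) = P * U * Q"
      by blast
    define S where "S = T - of_real a \<cdot>\<^sub>m 1\<^sub>m n"
    have S: "S \<in> carrier_mat n n" unfolding S_def by (intro minus_carrier_mat smult_carrier_mat one_carrier_mat)
    have S_tri: "upper_triangular S"
      using upper_triangularD[OF T(1)] w(5) by (auto simp: S_def intro!: upper_triangularI)
    have "function_mat vs (\<lambda>x z. M x z - a * of_bool (x = z)) = A - of_real a \<cdot>\<^sub>m 1\<^sub>m n"
      using vs by (intro eq_matI) (auto simp: A_def function_mat_def n_def nth_eq_iff_index_eq)
    also have "\<dots> = P * S * Q"
    proof -
      have "P * S * Q = P * T * Q - P * (of_real a \<cdot>\<^sub>m 1\<^sub>m n) * Q"
        using w(5-7) unfolding S_def
        by (simp add: mult_minus_distrib_mat[of P n n] minus_mult_distrib_mat[of _ n n])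
      also have "P * (of_real a \<cdot>\<^sub>m 1\<^sub>m n) * Q = of_real a \<cdot>\<^sub>m 1\<^sub>m n"
        using mult_smult_distrib[OF w(6) one_carrier_mat, of "of_real a"]
          mult_smult_assoc_mat[OF w(6,7), of "of_real a"] w(1,6) by simp
      finally show ?thesis using w(3) by simp
    qed
    finally have "function_mat vs (shifted_product (set vs) M (a # as)) = (P * S * Q) * (P * U * Q)"
      using function_mat_mult[OF vs, of "\<lambda>x z. M x z - a * of_bool (x = z)" "shifted_product (set vs) M as"] U(4)
      by simp
    also have "\<dots> = P * S * (Q * P) * U * Q"
      using w(6,7) S U(1) by (simp add: assoc_mult_mat[of _ n n _ n _ n])
    also have "\<dots> = P * (S * U) * Q"
      using w(2,6,7) S U(1) by (simp add: assoc_mult_mat[of _ n n _ n _ n])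
    finally have eq: "function_mat vs (shifted_product (set vs) M (a # as)) = P * (S * U) * Q" .
    show ?case
    proof (intro bexI[of _ "S * U"] conjI allI impI)
      show "upper_triangular (S * U)" by (rule upper_triangular_mult(1)[OF S S_tri U(1,2)])
      show "(S * U) $$ (i, i) = (\<Prod>a\<leftarrow>a # as. (T $$ (i, i) - of_real a))" if "i < n" for i
        using upper_triangular_mult(2)[OF S S_tri U(1,2) that] U(3) that w(5) by (simp add: S_def)
    qed (use eq S U(1) in auto)
  qed
  then obtain U where U: "U \<in> carrier_mat n n"
      "\<And>i. i < n \<Longrightarrow> U $$ (i, i) = (\<Prod>a\<leftarrow>as. (T $$ (i, i) - of_real a))"
      "function_mat vs (shifted_product (set vs) M as) = P * U * Q" by blast
  have "complex_of_real (\<Sum>x\<in>set vs. shifted_product (set vs) M as x x)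
      = (\<Sum>i<n. function_mat vs (shifted_product (set vs) M as) $$ (i, i))"
    by (simp add: sum_nth[OF vs, symmetric] function_mat_def n_def)
  also have "\<dots> = (\<Sum>i<n. (Q * (P * U)) $$ (i, i))"
    unfolding U(3) using w U(1) by (intro sum_diag_mult_commute) auto
  also have "Q * (P * U) = U"
    using w U(1) by (simp add: assoc_mult_mat[of Q n n P n U n, symmetric])
  also have "(\<Sum>i<n. U $$ (i, i)) = (\<Sum>i\<leftarrow>[0..<n]. \<Prod>a\<leftarrow>as. (T $$ (i, i) - of_real a))"
    using U(2) by (simp add: interv_sum_list_conv_sum_set_nat atLeast0LessThan)
  also have "\<dots> = (\<Sum>e\<leftarrow>es. \<Prod>a\<leftarrow>as. (e - of_real a))"
    unfolding T_es[symmetric] by (simp add: comp_def)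
  also have "\<dots> = (\<Sum>e\<in>#mset es. \<Prod>a\<leftarrow>as. (e - of_real a))"
    by (simp add: sum_mset_sum_list[symmetric] del: sum_mset_sum_list)
  also have "\<dots> = (\<Sum>r\<in>#R. of_real (\<Prod>a\<leftarrow>as. (r - a)))"
  proof -
    have "(\<Prod>a\<leftarrow>as. (complex_of_real r - of_real a)) = of_real (\<Prod>a\<leftarrow>as. (r - a))" for r
      by (induction as) auto
    then show ?thesis unfolding mset_es by (simp add: image_mset.compositionality comp_def)
  qed
  also have "\<dots> = complex_of_real (\<Sum>r\<in>#R. \<Prod>a\<leftarrow>as. (r - a))"
    by (induction R) auto
  finally show ?thesis by (simp only: of_real_eq_iff)
qed

text \<open>With \<open>bs = as\<close> and a symmetric product, this writes a diagonal entry for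
  the doubled list as a sum of squares along a row.\<close>

lemma shifted_product_append:
  assumes "finite V" "x \<in> V" "y \<in> V"
  shows "shifted_product V M (as @ bs) x y = (\<Sum>z\<in>V. shifted_product V M as x z * shifted_product V M bs z y)"
  using assms(2)
proof (induction as arbitrary: x)
  case Nil
  have "(\<Sum>z\<in>V. of_bool (x = z) * shifted_product V M bs z y)
      = (\<Sum>z\<in>{x}. of_bool (x = z) * shifted_product V M bs z y)"
    using assms(1) Nil by (intro sum.mono_neutral_right) auto
  then show ?case by simp
next
  case (Cons a as)
  let ?D = "\<lambda>x z. M x z - a * of_bool (x = z)"
  have "shifted_product V M ((a # as) @ bs) x y = (\<Sum>w\<in>V. ?D x w * shifted_product V M (as @ bs) w y)"
    by simp
  also have "\<dots> = (\<Sum>w\<in>V. \<Sum>z\<in>V. ?D x w * shifted_product V M as w z * shifted_product V M bs z y)"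
    by (intro sum.cong refl) (simp add: Cons.IH sum_distrib_left mult.assoc)
  also have "\<dots> = (\<Sum>z\<in>V. shifted_product V M (a # as) x z * shifted_product V M bs z y)"
    by (subst sum.swap) (simp add: sum_distrib_right)
  finally show ?case .
qed

section \<open>Local structure\<close>

text \<open>\<open>N x\<close> is the closed neighbourhood of \<open>x\<close>. With \<open>B = A + I\<close>, whose eigenvalues are \<open>s(2t + 1)\<close>,
  \<open>st\<close>, \<open>0\<close> and \<open>-s\<close>, the assumption \<open>cubic\<close> reads \<open>B(B - st)(B + s) = 2s\<^sup>2(2t + 1)J\<close>.\<close>

locale grid_spectrum =
  fixes V :: "'a set" and N :: "'a \<Rightarrow> 'a set" and s t :: nat
  assumes finite_V: "finite V"
    and N_subset: "x \<in> V \<Longrightarrow> N x \<subseteq> V"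
    and N_refl: "x \<in> V \<Longrightarrow> x \<in> N x"
    and N_sym: "x \<in> V \<Longrightarrow> y \<in> N x \<Longrightarrow> x \<in> N y"
    and card_V: "card V = s * (t + 1)\<^sup>2"
    and card_N: "x \<in> V \<Longrightarrow> card (N x) = s * (2 * t + 1)"
    and card_common: "x \<in> V \<Longrightarrow> y \<in> V \<Longrightarrow> y \<notin> N x \<Longrightarrow> card (N x \<inter> N y) = 2 * s"
    and cubic: "x \<in> V \<Longrightarrow> y \<in> V \<Longrightarrow> (\<Sum>z\<in>N x. real (card (N z \<inter> N y))) =
      real s * (real t - 1) * real (card (N x \<inter> N y)) + (real s)\<^sup>2 * real t * of_bool (y \<in> N x) +
      2 * (real s)\<^sup>2 * (2 * real t + 1)"
    and s_pos: "s \<ge> 1" and t_large: "t \<ge> 250" "t \<ge> 13 * s"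
begin

abbreviation adj :: "'a \<Rightarrow> 'a \<Rightarrow> real" where
  "adj x y \<equiv> of_bool (y \<in> N x)"

definition common :: "'a \<Rightarrow> 'a \<Rightarrow> real" where
  "common x y = real (card (N x \<inter> N y))"

text \<open>\<open>E\<close> is \<open>s\<close> times the orthogonal projection onto the span of the eigenspaces of \<open>B\<close> with
  nonzero eigenvalue. In the clique extension of the grid, it is the adjacency matrix of the
  relation of being equal or twins.\<close>

definition E :: "'a \<Rightarrow> 'a \<Rightarrow> real" where
  "E x y = (common x y - real s * (real t - 1) * adj x y - 2 * real s) / (real s * real t)"

section \<open>Algebraic identities for \<open>B\<close> and \<open>E\<close>\<close>

lemma st_pos: "real s > 0" "real t > 0"
  using s_pos t_large by auto

lemma N_sym_iff: "x \<in> V \<Longrightarrow> y \<in> V \<Longrightarrow> y \<in> N x \<longleftrightarrow> x \<in> N y"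
  using N_sym by blast

lemma finite_N: "x \<in> V \<Longrightarrow> finite (N x)"
  using N_subset finite_V finite_subset by blast

lemma card_N_real: "x \<in> V \<Longrightarrow> real (card (N x)) = real s * (2 * real t + 1)"
  by (subst card_N) (simp_all add: algebra_simps)

lemma sum_adj: "x \<in> V \<Longrightarrow> (\<Sum>z\<in>V. adj x z * f z) = (\<Sum>z\<in>N x. f z)"
  using N_subset[of x] finite_V
  by (intro sum.mono_neutral_cong_right) auto

lemma E_eq: "real s * real t * E x y = common x y - real s * (real t - 1) * adj x y - 2 * real s"
  using st_pos by (simp add: E_def)

lemma E_sym: "x \<in> V \<Longrightarrow> y \<in> V \<Longrightarrow> E x y = E y x"
  using N_sym_iff[of x y] by (simp add: E_def common_def Int_commute)

lemma E_nonadj: "x \<in> V \<Longrightarrow> y \<in> V \<Longrightarrow> y \<notin> N x \<Longrightarrow> E x y = 0"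
  by (simp add: E_def common_def card_common)

text \<open>On an edge the constants combine to \<open>s (t + 1)\<close>, the size of a line, so
  \<open>st E\<close> is the deviation from the count expected for two points of one line.\<close>

lemma common_adj:
  "y \<in> N x \<Longrightarrow> common x y = real s * (real t + 1) + real s * real t * E x y"
  using E_eq[of x y] by (simp add: algebra_simps)

lemma E_refl: "x \<in> V \<Longrightarrow> E x x = 1"
proof -
  assume x: "x \<in> V"
  have "common x x = real s * (2 * real t + 1)"
    using x by (simp add: common_def card_N_real)
  then have "real s * real t * E x x = real s * real t"
    using common_adj[OF N_refl[OF x]] by (simp add: algebra_simps)
  then show ?thesis using st_pos by simp
qed

lemma common_eq_sum: "x \<in> V \<Longrightarrow> y \<in> V \<Longrightarrow> common x y = (\<Sum>z\<in>V. adj x z * adj z y)"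
proof -
  assume x: "x \<in> V" and y: "y \<in> V"
  have "(\<Sum>z\<in>V. adj x z * adj z y) = (\<Sum>z\<in>V. of_bool (z \<in> N x \<inter> N y))"
    using N_sym_iff[OF y] by (intro sum.cong) auto
  also have "\<dots> = (\<Sum>z\<in>N x \<inter> N y. 1)"
    using N_subset[OF x] finite_V by (intro sum.mono_neutral_cong_right) auto
  finally show ?thesis by (simp add: common_def)
qed

lemma sum_common: "x \<in> V \<Longrightarrow> (\<Sum>z\<in>V. common x z) = (real s * (2 * real t + 1))\<^sup>2"
proof -
  assume x: "x \<in> V"
  have "(\<Sum>z\<in>V. common x z) = (\<Sum>z\<in>V. \<Sum>w\<in>V. adj x w * adj w z)"
    using x by (simp add: common_eq_sum)
  also have "\<dots> = (\<Sum>w\<in>V. adj x w * (\<Sum>z\<in>V. adj w z * 1))"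
    by (subst sum.swap) (simp add: sum_distrib_left)
  also have "\<dots> = (\<Sum>w\<in>N x. real s * (2 * real t + 1))"
    unfolding sum_adj[OF x] using N_subset[OF x]
    by (intro sum.cong refl) (subst sum_adj, auto simp: card_N_real)
  also have "\<dots> = (real s * (2 * real t + 1))\<^sup>2"
    using x by (simp add: card_N_real power2_eq_square)
  finally show ?thesis .
qed

text \<open>This is \<open>BE = sB\<close>. Since \<open>BJ = s(2t + 1)J\<close>, the
  \<open>J\<close> term of \<open>cubic\<close> cancels against the one in \<open>E\<close>.\<close>

lemma sum_adj_E: "x \<in> V \<Longrightarrow> y \<in> V \<Longrightarrow> (\<Sum>z\<in>V. adj x z * E z y) = real s * adj x y"
proof -
  assume x: "x \<in> V" and y: "y \<in> V"
  have "real s * real t * (\<Sum>z\<in>V. adj x z * E z y) =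
    (\<Sum>z\<in>V. adj x z * (real s * real t * E z y))"
    by (simp add: sum_distrib_left algebra_simps)
  also have "\<dots> = (\<Sum>z\<in>V. adj x z * common z y)
      - real s * (real t - 1) * (\<Sum>z\<in>V. adj x z * adj z y)
      - (\<Sum>z\<in>V. adj x z * (2 * real s))"
    unfolding E_eq by (simp add: sum_distrib_left sum_subtractf algebra_simps sum.distrib)
  also have "\<dots> = (\<Sum>z\<in>N x. common z y) - real s * (real t - 1) * common x y
      - real s * (2 * real t + 1) * (2 * real s)"
    using common_eq_sum[OF x y] by (simp only: sum_adj[OF x]) (simp add: card_N_real[OF x])
  also have "\<dots> = real s * real t * (real s * adj x y)"
    using cubic[OF x y] unfolding common_def by (simp add: power2_eq_square algebra_simps)
  finally show ?thesis using st_pos by simp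
qed

lemma sum_E_adj: "x \<in> V \<Longrightarrow> y \<in> V \<Longrightarrow> (\<Sum>z\<in>V. E x z * adj z y) = real s * adj x y"
proof -
  assume x: "x \<in> V" and y: "y \<in> V"
  have "(\<Sum>z\<in>V. E x z * adj z y) = (\<Sum>z\<in>V. adj y z * E z x)"
    using x y by (intro sum.cong refl) (simp add: E_sym[of x] N_sym_iff[of y] mult.commute)
  then show ?thesis using sum_adj_E[OF y x] N_sym_iff[OF x y] by simp
qed

lemma sum_E: "x \<in> V \<Longrightarrow> (\<Sum>z\<in>V. E x z) = real s"
proof -
  assume x: "x \<in> V"
  have adj_sum: "(\<Sum>z\<in>V. adj x z) = real s * (2 * real t + 1)"
    using sum_adj[OF x, of "\<lambda>_. 1"] by (simp add: card_N_real[OF x])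
  have "real s * real t * (\<Sum>z\<in>V. E x z) = (\<Sum>z\<in>V. real s * real t * E x z)"
    by (simp add: sum_distrib_left)
  also have "\<dots> = (\<Sum>z\<in>V. common x z) - real s * (real t - 1) * (\<Sum>z\<in>V. adj x z) - real (card V) * (2 * real s)"
    unfolding E_eq by (simp add: sum_distrib_left sum_subtractf)
  also have "\<dots> = real s * real t * real s"
    unfolding sum_common[OF x] adj_sum card_V by (simp add: power2_eq_square algebra_simps)
  finally show ?thesis using st_pos by simp
qed

text \<open>This is \<open>E^2 = sE\<close>: as \<open>E\<close> is a combination of
  \<open>B^2\<close>, \<open>B\<close> and \<open>J\<close>, it suffices that \<open>EB = sB\<close>
  and \<open>EJ = sJ\<close>.\<close>

lemma sum_E_E: "x \<in> V \<Longrightarrow> y \<in> V \<Longrightarrow> (\<Sum>z\<in>V. E x z * E z y) = real s * E x y"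
proof -
  assume x: "x \<in> V" and y: "y \<in> V"
  have "(\<Sum>z\<in>V. E x z * common z y) = (\<Sum>z\<in>V. \<Sum>w\<in>V. E x z * adj z w * adj w y)"
    using y by (simp add: common_eq_sum sum_distrib_left mult.assoc)
  also have "\<dots> = (\<Sum>w\<in>V. (\<Sum>z\<in>V. E x z * adj z w) * adj w y)"
    by (subst sum.swap) (simp add: sum_distrib_right)
  also have "\<dots> = real s * common x y"
    using x y by (simp add: sum_E_adj common_eq_sum sum_distrib_left mult.assoc)
  finally have *: "(\<Sum>z\<in>V. E x z * common z y) = real s * common x y" .
  have "real s * real t * (\<Sum>z\<in>V. E x z * E z y) = (\<Sum>z\<in>V. E x z * (real s * real t * E z y))"
    by (simp add: sum_distrib_left algebra_simps)
  also have "\<dots> = (\<Sum>z\<in>V. E x z * common z y)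
      - real s * (real t - 1) * (\<Sum>z\<in>V. E x z * adj z y) - (\<Sum>z\<in>V. E x z) * (2 * real s)"
    unfolding E_eq sum_distrib_left sum_distrib_right sum_subtractf[symmetric]
    by (intro sum.cong refl) (simp add: algebra_simps)
  also have "\<dots> = real s * (real s * real t * E x y)"
    unfolding * sum_E_adj[OF x y] sum_E[OF x] E_eq by (simp add: algebra_simps)
  finally show ?thesis using st_pos by simp
qed

text \<open>The diagonal of \<open>E^2 = sE\<close>. This fixed budget, of which the diagonal entry
  takes 1, limits how many edges at \<open>x\<close> can have a large \<open>E\<close>.\<close>

lemma sum_E_sq: "x \<in> V \<Longrightarrow> (\<Sum>z\<in>V. (E x z)\<^sup>2) = real s"
proof -
  assume x: "x \<in> V"
  have "(\<Sum>z\<in>V. (E x z)\<^sup>2) = (\<Sum>z\<in>V. E x z * E z x)"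
    using x by (intro sum.cong refl) (simp add: E_sym[of x] power2_eq_square)
  then show ?thesis using sum_E_E[OF x x] E_refl[OF x] by simp
qed

text \<open>An entry of \<open>BE = sB\<close> at an edge; the sum may be restricted to
  \<open>N y\<close> because \<open>E\<close> vanishes on nonadjacent pairs.\<close>

lemma sum_E_common: "x \<in> V \<Longrightarrow> y \<in> N x \<Longrightarrow> (\<Sum>w\<in>N x \<inter> N y. E w y) = real s"
proof -
  assume x: "x \<in> V" and y: "y \<in> N x"
  then have yV: "y \<in> V" using N_subset by blast
  have "(\<Sum>w\<in>N x \<inter> N y. E w y) = (\<Sum>w\<in>N x. E w y)"
    using x yV N_subset[OF x] N_sym_iff[of y] finite_N[OF x]
    by (intro sum.mono_neutral_left) (auto intro!: E_nonadj)
  also have "\<dots> = (\<Sum>z\<in>V. adj x z * E z y)" using sum_adj[OF x] by simp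
  finally show ?thesis using sum_adj_E[OF x yV] y by simp
qed

text \<open>Cauchy-Schwarz for \<open>E w x + E w y\<close> over the common neighbours \<open>w\<close> of \<open>x\<close> and \<open>y\<close>.\<close>

lemma edge_common_bound:
  assumes x: "x \<in> V" and y: "y \<in> N x"
  shows "common x y * (common x y - real s) \<ge> 2 * (real s)\<^sup>2 * real t"
proof -
  let ?W = "N x \<inter> N y"
  have yV: "y \<in> V" using N_subset x y by blast
  have W: "?W \<subseteq> V" using N_subset[OF x] by blast
  have 2: "(\<Sum>w\<in>?W. E w x) = real s"
    using sum_E_common[OF yV N_sym[OF x y]] by (simp add: Int_commute)
  have sum2: "(\<Sum>w\<in>?W. E w x + E w y) = 2 * real s"
    using sum_E_common[OF x y] 2 by (simp add: sum.distrib)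
  \<comment> \<open>Summing over all of \<open>V\<close> makes the squares computable from
    \<open>E^2 = sE\<close>.\<close>
  have "(\<Sum>w\<in>?W. (E w x + E w y)\<^sup>2) \<le> (\<Sum>w\<in>V. (E w x + E w y)\<^sup>2)"
    using W finite_V by (intro sum_mono2) auto
  also have "\<dots> = (\<Sum>w\<in>V. E x w * E w x) + 2 * (\<Sum>w\<in>V. E x w * E w y) + (\<Sum>w\<in>V. E y w * E w y)"
    unfolding sum_distrib_left sum.distrib[symmetric] using x yV
    by (intro sum.cong refl) (simp add: E_sym[of x] E_sym[of y] power2_eq_square algebra_simps)
  also have "\<dots> = 2 * real s * (1 + E x y)"
    unfolding sum_E_E[OF x x] sum_E_E[OF x yV] sum_E_E[OF yV yV] E_refl[OF x] E_refl[OF yV]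
    by (simp add: algebra_simps)
  finally have sq: "(\<Sum>w\<in>?W. (E w x + E w y)\<^sup>2) \<le> 2 * real s * (1 + E x y)" .
  have "(2 * real s)\<^sup>2 \<le> (\<Sum>w\<in>?W. (E w x + E w y)\<^sup>2) * common x y"
    using sum_squared_le_sum_of_squares[of "\<lambda>w. E w x + E w y" ?W] sum2
    by (simp add: common_def)
  also have "\<dots> \<le> 2 * real s * (1 + E x y) * common x y"
    using sq by (simp add: common_def mult_right_mono)
  finally have "2 * real s * (2 * real s) \<le> 2 * real s * ((1 + E x y) * common x y)"
    by (simp add: power2_eq_square algebra_simps)
  then have *: "2 * real s \<le> (1 + E x y) * common x y"
    using st_pos by (simp only: mult_le_cancel_left_pos)
  \<comment> \<open>On an edge \<open>st (1 + E x y) = common x y - s\<close>, so multiplying by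
    \<open>st\<close> eliminates \<open>E\<close>.\<close>
  have "real s * real t * (2 * real s) \<le> real s * real t * ((1 + E x y) * common x y)"
    using * by (intro mult_left_mono) auto
  also have "\<dots> = common x y * (common x y - real s)"
    using common_adj[OF y] by (simp add: algebra_simps)
  finally show ?thesis by (simp add: power2_eq_square algebra_simps)
qed

section \<open>The bound on cliques\<close>

text \<open>With \<open>u\<close> the indicator vector of \<open>K\<close> and \<open>F\<close>
  symmetric, this is the inner product of \<open>Fu\<close> and \<open>Gu\<close> written as the
  quadratic form of \<open>FG\<close> at \<open>u\<close>.\<close>

lemma sum_sum_product:
  assumes "K \<subseteq> V"
    and "\<And>x y. x \<in> V \<Longrightarrow> y \<in> V \<Longrightarrow> f x y = f y x"
  shows "(\<Sum>z\<in>V. (\<Sum>x\<in>K. f z x) * (\<Sum>y\<in>K. g z y)) = (\<Sum>x\<in>K. \<Sum>y\<in>K. \<Sum>z\<in>V. f x z * (g z y::real))"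
proof -
  have "(\<Sum>z\<in>V. (\<Sum>x\<in>K. f z x) * (\<Sum>y\<in>K. g z y)) = (\<Sum>z\<in>V. \<Sum>x\<in>K. \<Sum>y\<in>K. f x z * g z y)"
    unfolding sum_product using assms by (intro sum.cong refl) (auto simp: subset_iff)
  also have "\<dots> = (\<Sum>x\<in>K. \<Sum>z\<in>V. \<Sum>y\<in>K. f x z * g z y)"
    by (rule sum.swap)
  also have "\<dots> = (\<Sum>x\<in>K. \<Sum>y\<in>K. \<Sum>z\<in>V. f x z * g z y)"
    by (rule sum.cong[OF refl], rule sum.swap)
  finally show ?thesis .
qed

definition clique :: "'a set \<Rightarrow> bool" where
  "clique K \<longleftrightarrow> K \<subseteq> V \<and> (\<forall>x\<in>K. K \<subseteq> N x)"

text \<open>A Hoffman-type bound with \<open>u\<close> the indicator vector of \<open>K\<close> and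
  \<sigma> the quadratic form of \<open>E\<close> at \<open>u\<close>. Projecting \<open>u\<close>
  to the \<open>-s\<close>-eigenspace gives \<open>c^2 <= (t + 1)\<close> \<sigma>, and \<sigma> is
  at most \<open>s c\<close> because \<open>E\<close> is \<open>s\<close> times a
  projection.\<close>

lemma clique_card_le:
  assumes "clique K"
  shows "card K \<le> s * (t + 1)"
proof -
  have K: "K \<subseteq> V" and KN: "\<And>x y. x \<in> K \<Longrightarrow> y \<in> K \<Longrightarrow> y \<in> N x"
    using assms by (auto simp: clique_def)
  define c where "c = real (card K)"
  define e where "e z = (\<Sum>x\<in>K. E z x)" for z
  define d where "d z = (\<Sum>x\<in>K. adj z x)" for z
  define \<sigma> where "\<sigma> = (\<Sum>x\<in>K. \<Sum>y\<in>K. E x y)"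
  \<comment> \<open>Chosen so that \<open>t E - B + h J\<close> kills the all-ones vector:
    \<open>t s - s (2 t + 1) + h s (t + 1)^2 = 0\<close>.\<close>
  define h where "h = 1 / (real t + 1)"
  have h: "h * (real t + 1) = 1" by (simp add: h_def add_nonneg_pos)
  have adj1: "(\<Sum>x\<in>K. \<Sum>y\<in>K. adj x y) = c * c"
    using KN by (simp add: c_def)
  have "(\<Sum>z\<in>V. e z * e z) = (\<Sum>x\<in>K. \<Sum>y\<in>K. \<Sum>z\<in>V. E x z * E z y)"
    unfolding e_def using K E_sym by (intro sum_sum_product) auto
  also have "\<dots> = (\<Sum>x\<in>K. \<Sum>y\<in>K. real s * E x y)"
    using K by (intro sum.cong refl sum_E_E) auto
  finally have ee: "(\<Sum>z\<in>V. e z * e z) = real s * \<sigma>"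
    by (simp add: \<sigma>_def sum_distrib_left)
  have ed: "(\<Sum>z\<in>V. e z * d z) = real s * (c * c)"
    unfolding e_def d_def adj1[symmetric] using K E_sym
    by (subst sum_sum_product) (auto simp: sum_E_adj subset_iff sum_distrib_left intro!: sum.cong)
  have "(\<Sum>z\<in>V. d z * d z) = (\<Sum>x\<in>K. \<Sum>y\<in>K. common x y)"
    unfolding d_def using K N_sym_iff
    by (subst sum_sum_product) (auto simp: common_eq_sum subset_iff intro!: sum.cong)
  also have "\<dots> = (\<Sum>x\<in>K. \<Sum>y\<in>K. real s * (real t + 1) + real s * real t * E x y)"
    using KN by (intro sum.cong refl) (simp add: common_adj)
  also have "\<dots> = real s * (real t + 1) * (c * c) + real s * real t * \<sigma>"
    by (simp add: sum.distrib \<sigma>_def sum_distrib_left c_def)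
  finally have dd: "(\<Sum>z\<in>V. d z * d z) = real s * (real t + 1) * (c * c) + real s * real t * \<sigma>" .
  have "(\<Sum>z\<in>V. e z) = (\<Sum>x\<in>K. \<Sum>z\<in>V. E x z)"
    unfolding e_def using K by (subst sum.swap) (auto simp: E_sym subset_iff intro!: sum.cong)
  then have e1: "(\<Sum>z\<in>V. e z) = real s * c"
    using K by (simp add: sum_E subset_iff c_def)
  have "(\<Sum>z\<in>V. d z) = (\<Sum>x\<in>K. \<Sum>z\<in>V. adj x z * 1)"
    unfolding d_def using K by (subst sum.swap) (auto simp: N_sym_iff subset_iff intro!: sum.cong)
  also have "\<dots> = (\<Sum>x\<in>K. real s * (2 * real t + 1))"
    using K by (intro sum.cong refl) (subst sum_adj, auto simp: card_N_real)
  finally have d1: "(\<Sum>z\<in>V. d z) = real s * (2 * real t + 1) * c"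
    by (simp add: c_def)
  \<comment> \<open>\<open>t E - B + J / (t + 1)\<close> is a multiple of the projection onto the \<open>-s\<close>-eigenspace of \<open>B\<close>.\<close>
  have "0 \<le> (\<Sum>z\<in>V. (real t * e z - d z + h * c)\<^sup>2)"
    by (intro sum_nonneg) simp
  also have "\<dots> = (\<Sum>z\<in>V. (real t)\<^sup>2 * (e z * e z) + d z * d z + (h * c)\<^sup>2
      - 2 * real t * (e z * d z) + 2 * real t * h * c * e z - 2 * h * c * d z)"
    by (intro sum.cong refl) (simp add: power2_eq_square algebra_simps)
  also have "\<dots> = (real t)\<^sup>2 * (\<Sum>z\<in>V. e z * e z) + (\<Sum>z\<in>V. d z * d z) + real (card V) * (h * c)\<^sup>2
      - 2 * real t * (\<Sum>z\<in>V. e z * d z) + 2 * real t * h * c * (\<Sum>z\<in>V. e z) - 2 * h * c * (\<Sum>z\<in>V. d z)"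
    by (simp add: sum.distrib sum_subtractf sum_distrib_left)
  also have "\<dots> = (real t)\<^sup>2 * (real s * \<sigma>) + (real s * (real t + 1) * (c * c) + real s * real t * \<sigma>)
      + real s * (h * (real t + 1))\<^sup>2 * c\<^sup>2
      - 2 * real t * (real s * (c * c)) - 2 * real s * (h * (real t + 1)) * (c * c)"
    unfolding ee ed dd e1 d1 card_V by (simp add: power2_eq_square algebra_simps)
  also have "\<dots> = real s * real t * ((real t + 1) * \<sigma> - c * c)"
    unfolding h by (simp add: power2_eq_square algebra_simps)
  finally have "real s * real t * 0 \<le> real s * real t * ((real t + 1) * \<sigma> - c * c)"
    by simp
  then have \<sigma>1: "c * c \<le> (real t + 1) * \<sigma>"
    using st_pos by (subst (asm) mult_le_cancel_left_pos) auto
  have \<sigma>0: "\<sigma> \<ge> 0"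
  proof (rule ccontr)
    assume "\<not> 0 \<le> \<sigma>"
    then have "(real t + 1) * \<sigma> < 0" by (intro mult_pos_neg) auto
    then show False using \<sigma>1 zero_le_square[of c] by linarith
  qed
  have "\<sigma>\<^sup>2 = (\<Sum>z\<in>K. e z)\<^sup>2" by (simp add: \<sigma>_def e_def)
  also have "\<dots> \<le> (\<Sum>z\<in>K. (e z)\<^sup>2) * c"
    unfolding c_def by (rule sum_squared_le_sum_of_squares)
  also have "\<dots> \<le> (\<Sum>z\<in>V. (e z)\<^sup>2) * c"
    using K finite_V by (intro mult_right_mono sum_mono2) (auto simp: c_def)
  also have "\<dots> = real s * \<sigma> * c"
    using ee by (simp add: power2_eq_square)
  finally have "\<sigma> * \<sigma> \<le> (real s * c) * \<sigma>" by (simp add: power2_eq_square algebra_simps)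
  then have "\<sigma> \<le> real s * c"
    using \<sigma>0 by (cases "\<sigma> = 0") (auto simp: c_def mult_le_cancel_right)
  then have "(real t + 1) * \<sigma> \<le> (real t + 1) * (real s * c)" by (intro mult_left_mono) auto
  then have "c * c \<le> (real s * (real t + 1)) * c"
    using \<sigma>1 by (simp add: algebra_simps)
  then have "c \<le> real s * (real t + 1)"
    by (cases "c = 0") (auto simp: c_def mult_le_cancel_right)
  then have "real (card K) \<le> real (s * (t + 1))" by (simp add: c_def algebra_simps)
  then show ?thesis by (simp only: of_nat_le_iff)
qed


section \<open>Two large cliques in each neighbourhood\<close>

text \<open>The neighbours of \<open>z\<close> in \<open>C\<close> are common neighbours of
  \<open>z\<close> and of any member of \<open>C\<close> not adjacent to \<open>z\<close>.\<close>

lemma common_clique_le: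
  assumes "clique C" "z \<in> V" "\<not> C \<subseteq> N z"
  shows "card (N z \<inter> C) \<le> 2 * s"
proof -
  obtain c where c: "c \<in> C" "c \<notin> N z" using assms(3) by blast
  then have "N z \<inter> C \<subseteq> N z \<inter> N c" "c \<in> V"
    using assms(1) by (auto simp: clique_def)
  then have "card (N z \<inter> C) \<le> card (N z \<inter> N c)"
    using assms(2) finite_N by (intro card_mono) auto
  also have "\<dots> = 2 * s" using card_common assms(2) c \<open>c \<in> V\<close> by blast
  finally show ?thesis .
qed

text \<open>All but \<open>16(s - 1)\<close> neighbours of \<open>x\<close> have about \<open>st\<close> neighbours in \<open>N x\<close>; as \<open>N x\<close> has only about
  \<open>2st\<close> elements and nonadjacent vertices have few common neighbours, no three of them are pairwise
  nonadjacent.\<close>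

lemma two_cliques_cover:
  assumes x: "x \<in> V"
  obtains C1 C2 where "clique C1" "clique C2" "C1 \<subseteq> N x" "C2 \<subseteq> N x"
    "card C1 > 2 * s" "card C2 > 2 * s" "card (N x - (C1 \<union> C2)) \<le> 18 * s"
proof -
  \<comment> \<open>Outside \<open>B\<close> the bound is \<open>|E x y| <= 1/4\<close>, so a
    neighbour shares at least \<open>3/4 st\<close> vertices with \<open>N x\<close>. Three such
    sets, nearly disjoint, do not fit into about \<open>2 st\<close> vertices.\<close>
  define B where "B = {y \<in> N x - {x}. (E x y)\<^sup>2 > 1/16}"
  define G where "G = N x - {x} - B"
  have NV: "N x \<subseteq> V" and finN: "finite (N x)" using N_subset[OF x] finite_N[OF x] by auto
  have finB: "finite B" and finG: "finite G" using finN by (auto simp: B_def G_def)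
  have GN: "G \<subseteq> N x" and GV: "G \<subseteq> V" using NV by (auto simp: G_def)
  have s1: "real s \<ge> 1" using s_pos by simp
  have st: "real s * real t \<ge> 250 * real s"
    using t_large(1) st_pos by (simp add: mult.commute[of "real s"])
  \<comment> \<open>In the row norm \<open>s\<close> the diagonal takes 1 and each member of
    \<open>B\<close> more than \<open>1/16\<close>.\<close>
  have "1 + real (card B) * (1/16) \<le> (E x x)\<^sup>2 + (\<Sum>y\<in>B. (E x y)\<^sup>2)"
    using sum_mono[of B "\<lambda>_. 1/16" "\<lambda>y. (E x y)\<^sup>2"] E_refl[OF x] by (simp add: B_def)
  also have "\<dots> = (\<Sum>y\<in>insert x B. (E x y)\<^sup>2)"
    using finB by (subst sum.insert) (auto simp: B_def)
  also have "\<dots> \<le> (\<Sum>y\<in>V. (E x y)\<^sup>2)"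
    using NV x finite_V by (intro sum_mono2) (auto simp: B_def)
  finally have cardB: "real (card B) \<le> 16 * (real s - 1)"
    using sum_E_sq[OF x] by simp
  have common_G: "3/4 * (real s * real t) + real s \<le> common x y \<and>
      common x y \<le> 5/4 * (real s * real t) + real s" if "y \<in> G" for y
  proof -
    have "(E x y)\<^sup>2 \<le> (1/4)\<^sup>2" using that by (auto simp: G_def B_def power2_eq_square)
    then have "\<bar>E x y\<bar> \<le> 1/4" using abs_le_square_iff[of "E x y" "1/4"] by simp
    then have "E x y \<ge> -1/4" "E x y \<le> 1/4" by auto
    then have "real s * real t * E x y \<ge> real s * real t * (-1/4)"
        "real s * real t * E x y \<le> real s * real t * (1/4)"
      by (intro mult_left_mono; simp)+
    then show ?thesis using common_adj[of y x] that GN by (auto simp: algebra_simps)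
  qed
  have no_coclique: False
    if y: "y1 \<in> G" "y2 \<in> G" "y3 \<in> G" and n: "y1 \<notin> N y2" "y1 \<notin> N y3" "y2 \<notin> N y3" for y1 y2 y3
  proof -
    define Y where "Y y = N x \<inter> N y" for y
    have finY: "finite (Y y)" for y using finN by (simp add: Y_def)
    have pair: "card (Y a \<inter> Y b) \<le> 2 * s" if "a \<in> V" "b \<in> V" "b \<notin> N a" for a b
    proof -
      have "card (Y a \<inter> Y b) \<le> card (N a \<inter> N b)"
        using that finite_N by (intro card_mono) (auto simp: Y_def)
      then show ?thesis using card_common that by simp
    qed
    \<comment> \<open>Truncated inclusion-exclusion, with each pairwise overlap at most
      \<open>2 s\<close>.\<close>
    have "card (Y y1) + card (Y y2) = card (Y y1 \<union> Y y2) + card (Y y1 \<inter> Y y2)"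
      using finY by (intro card_Un_Int) auto
    moreover have "card (Y y1 \<union> Y y2) + card (Y y3)
        = card (Y y1 \<union> Y y2 \<union> Y y3) + card ((Y y1 \<union> Y y2) \<inter> Y y3)"
      using finY by (intro card_Un_Int) auto
    moreover have "card ((Y y1 \<union> Y y2) \<inter> Y y3) \<le> card (Y y1 \<inter> Y y3) + card (Y y2 \<inter> Y y3)"
      unfolding Int_Un_distrib2 by (rule card_Un_le)
    moreover have "card (Y y1 \<union> Y y2 \<union> Y y3) \<le> card (N x)"
      using finN by (intro card_mono) (auto simp: Y_def)
    moreover have "card (Y y1 \<inter> Y y2) \<le> 2 * s" "card (Y y1 \<inter> Y y3) \<le> 2 * s" "card (Y y2 \<inter> Y y3) \<le> 2 * s"
      using pair y n GV N_sym_iff by blast+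
    ultimately have "card (Y y1) + card (Y y2) + card (Y y3) \<le> card (N x) + 6 * s" by linarith
    then have "common x y1 + common x y2 + common x y3 \<le> real (card (N x) + 6 * s)"
      unfolding common_def Y_def by linarith
    then show False
      using common_G[OF y(1)] common_G[OF y(2)] common_G[OF y(3)] card_N_real[OF x] st st_pos
      by (simp add: algebra_simps)
  qed
  have "N x \<subseteq> insert x (B \<union> G)" by (auto simp: G_def)
  then have "card (N x) \<le> card (insert x (B \<union> G))" using finB finG by (intro card_mono) auto
  also have "\<dots> \<le> 1 + (card B + card G)"
    using card_insert_le_m1 card_Un_le[of B G] finB finG by (simp add: card_insert_if)
  finally have "real (card (N x)) \<le> real (1 + (card B + card G))" by (simp only: of_nat_le_iff)
  then have cardG: "real (card G) \<ge> 2 * (real s * real t) - 15 * real s + 15"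
    using cardB card_N_real[OF x] by (simp add: algebra_simps)
  have card_diff: "real (card (G - N y)) \<ge> 3/4 * (real s * real t) - 16 * real s + 15" if "y \<in> G" for y
  proof -
    have "card (G - N y) + card (N x \<inter> N y) \<ge> card (G - N y) + card (G \<inter> N y)"
      using finN GN by (intro add_left_mono card_mono) auto
    also have "card (G - N y) + card (G \<inter> N y) = card ((G - N y) \<union> (G \<inter> N y))"
      using finG by (subst card_Un_disjoint) auto
    also have "(G - N y) \<union> (G \<inter> N y) = G" by auto
    finally have "real (card G) \<le> real (card (G - N y)) + common x y" by (simp add: common_def)
    then show ?thesis using common_G[OF that] cardG by linarith
  qed
  have "real (card G) > 0" using cardG st s1 by linarith
  then have "G \<noteq> {}" by auto
  then obtain y1 where y1: "y1 \<in> G" by blast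
  have "real (card (G - N y1)) > 0" using card_diff[OF y1] st s1 by linarith
  then have "G - N y1 \<noteq> {}" by force
  then obtain y2 where y2: "y2 \<in> G" "y2 \<notin> N y1" by blast
  have y21: "y1 \<notin> N y2" using y1 y2 GV N_sym_iff by blast
  have V12: "y1 \<in> V" "y2 \<in> V" using y1 y2 GV by auto
  \<comment> \<open>Two nonadjacent members of \<open>G - N y\<close> would form a coclique of size
    three with \<open>y\<close>.\<close>
  have cl: "clique (G - N y)" if "y \<in> G" for y
    unfolding clique_def
  proof (intro conjI ballI subsetI)
    fix a b assume ab: "a \<in> G - N y" "b \<in> G - N y"
    show "b \<in> N a"
      using no_coclique[of b a y] ab that by blast
  qed (use GV in auto)
  have big: "card (G - N y) > 2 * s" if "y \<in> G" for y
  proof -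
    have "real (card (G - N y)) > 2 * real s"
      using card_diff[OF that] st s1 by linarith
    then show ?thesis by linarith
  qed
  \<comment> \<open>What the two cliques miss of \<open>G\<close> is adjacent to both
    \<open>y1\<close> and \<open>y2\<close>, hence at most \<open>2 s\<close> vertices. Together
    with \<open>x\<close> and \<open>B\<close> this stays below \<open>18 s\<close>.\<close>
  have "N x - ((G - N y2) \<union> (G - N y1)) \<subseteq> insert x (B \<union> (N y1 \<inter> N y2))"
    by (auto simp: G_def)
  then have "card (N x - ((G - N y2) \<union> (G - N y1))) \<le> card (insert x (B \<union> (N y1 \<inter> N y2)))"
    using finB finite_N V12 by (intro card_mono) auto
  also have "\<dots> \<le> 1 + (card B + card (N y1 \<inter> N y2))"
    using card_Un_le[of B "N y1 \<inter> N y2"] finB finite_N V12 by (simp add: card_insert_if)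
  also have "card (N y1 \<inter> N y2) = 2 * s" using card_common V12 y2 by blast
  finally have "real (card (N x - ((G - N y2) \<union> (G - N y1)))) \<le> real (1 + (card B + 2 * s))"
    by (simp only: of_nat_le_iff)
  then have "real (card (N x - ((G - N y2) \<union> (G - N y1)))) \<le> real (18 * s)"
    using cardB s1 by simp
  then have "card (N x - ((G - N y2) \<union> (G - N y1))) \<le> 18 * s" by (simp only: of_nat_le_iff)
  then show thesis
    using that[of "G - N y2" "G - N y1"] cl big y1 y2(1) GN by blast
qed

text \<open>Each clique of the cover is enlarged to all neighbours of \<open>x\<close> joined to the
  whole of it. The enlarged cliques cover \<open>N x\<close>, and the row norm of \<open>E\<close>
  then forces all their sizes to be exact.\<close>

lemma local_structure:
  assumes x: "x \<in> V"
  obtains K1 K2 where "K1 \<union> K2 = N x" "card K1 = s * (t + 1)" "card K2 = s * (t + 1)"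
    "card (K1 \<inter> K2) = s" "x \<in> K1" "x \<in> K2" "\<forall>w\<in>K1 \<inter> K2. N w = N x"
    "\<forall>z\<in>K1 - K2. N x \<inter> N z = K1" "\<forall>z\<in>K2 - K1. N x \<inter> N z = K2"
proof -
  obtain C1 C2 where cl: "clique C1" "clique C2" and CN: "C1 \<subseteq> N x" "C2 \<subseteq> N x"
    and big: "card C1 > 2 * s" "card C2 > 2 * s" and rest: "card (N x - (C1 \<union> C2)) \<le> 18 * s"
    using two_cliques_cover[OF x] by blast
  have NV: "N x \<subseteq> V" and finN: "finite (N x)" using N_subset[OF x] finite_N[OF x] by auto
  have s1: "real s \<ge> 1" using s_pos by simp
  have st: "real s * real t \<ge> 250 * real s"
    using t_large(1) st_pos by (simp add: mult.commute[of "real s"])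
  define K where "K C = {z \<in> N x. C \<subseteq> N z}" for C
  have K_sub: "K C \<subseteq> N x" "finite (K C)" for C using finN by (auto simp: K_def)
  \<comment> \<open>Two nonadjacent members would have all of \<open>C\<close>, more than
    \<open>2 s\<close> vertices, as common neighbours.\<close>
  have K_clique: "clique (K C)" if "clique C" "card C > 2 * s" for C
    unfolding clique_def
  proof (intro conjI ballI subsetI)
    show "z \<in> V" if "z \<in> K C" for z using that NV by (auto simp: K_def)
    fix a b assume ab: "a \<in> K C" "b \<in> K C"
    then have V: "a \<in> V" "b \<in> V" using NV by (auto simp: K_def)
    show "b \<in> N a"
    proof (rule ccontr)
      assume "b \<notin> N a"
      then have "card (N a \<inter> N b) = 2 * s" using card_common V by blast
      moreover have "card C \<le> card (N a \<inter> N b)"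
        using ab finite_N V by (intro card_mono) (auto simp: K_def)
      ultimately show False using that by simp
    qed
  qed
  \<comment> \<open>Otherwise \<open>x\<close> and \<open>z\<close> share at most
    \<open>2 s + 2 s + 18 s = 22 s\<close> vertices, and \<open>edge_common_bound\<close> gives
    \<open>2 s^2 t <= 22 s * 21 s = 462 s^2\<close>, against \<open>t >= 250\<close>.\<close>
  have cover: "C1 \<subseteq> N z \<or> C2 \<subseteq> N z" if z: "z \<in> N x" for z
  proof (rule ccontr)
    assume "\<not> ?thesis"
    then have "card (N z \<inter> C1) \<le> 2 * s" "card (N z \<inter> C2) \<le> 2 * s"
      using common_clique_le cl z NV by auto
    moreover have "card (N x \<inter> N z) \<le> card (N z \<inter> C1 \<union> (N z \<inter> C2) \<union> (N x - (C1 \<union> C2)))"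
      using finN CN finite_subset[OF CN(1)] finite_subset[OF CN(2)] by (intro card_mono) auto
    moreover have "\<dots> \<le> card (N z \<inter> C1) + card (N z \<inter> C2) + card (N x - (C1 \<union> C2))"
      by (intro card_Un_le[THEN order_trans] add_mono order_refl)
    ultimately have "card (N x \<inter> N z) \<le> 22 * s" using rest by linarith
    then have m: "common x z \<le> 22 * real s" unfolding common_def by linarith
    have "2 * (real s)\<^sup>2 * real t \<le> common x z * (common x z - real s)"
      using edge_common_bound[OF x z] .
    also have "\<dots> \<le> common x z * (21 * real s)"
      using m by (intro mult_left_mono) (auto simp: common_def)
    also have "\<dots> \<le> (22 * real s) * (21 * real s)"
      using m s1 by (intro mult_right_mono) auto
    finally have "real s * (2 * (real s * real t)) \<le> real s * (462 * real s)"
      by (simp add: power2_eq_square algebra_simps)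
    then have "2 * (real s * real t) \<le> 462 * real s"
      using st_pos(1) by (subst (asm) mult_le_cancel_left_pos)
    then show False using st s1 by linarith
  qed
  define K1 where "K1 = K C1"
  define K2 where "K2 = K C2"
  have cK: "clique K1" "clique K2" using K_clique cl big by (auto simp: K1_def K2_def)
  have fin: "finite K1" "finite K2" using K_sub by (auto simp: K1_def K2_def)
  have un: "K1 \<union> K2 = N x" using cover by (auto simp: K1_def K2_def K_def)
  have xK: "x \<in> K1" "x \<in> K2" using N_refl[OF x] CN by (auto simp: K1_def K2_def K_def)
  have le: "card K1 \<le> s * (t + 1)" "card K2 \<le> s * (t + 1)" using clique_card_le cK by auto
  define T where "T = K1 \<inter> K2"
  have cards: "card K1 + card K2 = s * (2 * t + 1) + card T"
    using card_Un_Int[OF fin] un card_N[OF x] by (simp add: T_def)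
  \<comment> \<open>Both cliques have at most \<open>s (t + 1)\<close> vertices, while their sizes
    add up to \<open>s (2 t + 1) + card T\<close>.\<close>
  have T_le: "card T \<le> s" using cards le by (simp add: algebra_simps)
  have twin: "N w = N x" if "w \<in> T" for w
  proof -
    have "K1 \<union> K2 \<subseteq> N w" "w \<in> V"
      using that cK by (auto simp: T_def clique_def)
    then have "N x \<subseteq> N w" "w \<in> V"
      unfolding un .
    then show ?thesis using card_subset_eq[OF finite_N] card_N x by metis
  qed
  have Kadj: "K1 \<subseteq> N x \<inter> N z" if "z \<in> K1" for z using that cK un by (auto simp: clique_def)
  have Kadj2: "K2 \<subseteq> N x \<inter> N z" if "z \<in> K2" for z using that cK un by (auto simp: clique_def)
  have side: "card (N x \<inter> N z) \<le> card (K C) + 2 * s"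
    if "clique C'" "C' \<subseteq> N x" "card C' > 2 * s" "K C \<union> K C' = N x" "z \<in> K C - K C'" for z C C'
  proof -
    have z: "z \<in> V" "z \<in> N x" "\<not> C' \<subseteq> N z" using that NV K_sub by (auto simp: K_def)
    have "C' \<subseteq> K C'" using that(1,2) by (auto simp: K_def clique_def)
    then have "card (N z \<inter> K C') \<le> 2 * s"
      using common_clique_le[OF K_clique[OF that(1,3)]] z by blast
    moreover have "card (N x \<inter> N z) \<le> card (K C \<union> (N z \<inter> K C'))"
      using that(4) K_sub by (intro card_mono) auto
    moreover have "\<dots> \<le> card (K C) + card (N z \<inter> K C')" by (rule card_Un_le)
    ultimately show ?thesis by linarith
  qed
  \<comment> \<open>Off \<open>T\<close> the count \<open>common x z\<close> lies between
    \<open>s t\<close> and \<open>s (t + 3)\<close>, that is, within \<open>2 s\<close> of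
    \<open>s (t + 1)\<close>.\<close>
  have E_small: "(E x z)\<^sup>2 * (real t)\<^sup>2 \<le> 4" if z: "z \<in> N x - T" for z
  proof -
    have "card (N x \<inter> N z) \<le> s * (t + 1) + 2 * s \<and> s * t \<le> card (N x \<inter> N z)"
    proof (cases "z \<in> K1")
      case True
      then have "z \<in> K C1 - K C2" using z by (auto simp: T_def K1_def K2_def)
      then have "card (N x \<inter> N z) \<le> card K1 + 2 * s"
        using side[OF cl(2) CN(2) big(2), of C1 z] un by (simp add: K1_def K2_def)
      moreover have "card K1 \<le> card (N x \<inter> N z)"
        using Kadj[OF True] finN by (intro card_mono) auto
      ultimately show ?thesis using le cards by (simp add: algebra_simps)
    next
      case False
      then have z2: "z \<in> K C2 - K C1" using z un by (auto simp: K1_def K2_def)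
      then have "card (N x \<inter> N z) \<le> card K2 + 2 * s"
        using side[OF cl(1) CN(1) big(1), of C2 z] un by (simp add: K1_def K2_def Un_commute)
      moreover have "card K2 \<le> card (N x \<inter> N z)"
        using Kadj2[of z] z2 finN by (intro card_mono) (auto simp: K2_def)
      ultimately show ?thesis using le cards by (simp add: algebra_simps)
    qed
    then have "common x z \<le> real (s * (t + 1) + 2 * s)" "real (s * t) \<le> common x z"
      unfolding common_def by linarith+
    then have "real s * (real t * E x z) \<le> real s * 2" "real s * (-2) \<le> real s * (real t * E x z)"
      using common_adj[of z x] z s1 by (auto simp: algebra_simps)
    then have "\<bar>real t * E x z\<bar> \<le> \<bar>2\<bar>"
      using st_pos(1) by (simp only: mult_le_cancel_left_pos)
    then have "(real t * E x z)\<^sup>2 \<le> 2\<^sup>2" by (simp only: abs_le_square_iff)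
    then show ?thesis by (simp add: power_mult_distrib mult.commute)
  qed
  have E_T: "E x w = 1" if "w \<in> T" for w
  proof -
    have "w \<in> N x" using that un by (auto simp: T_def)
    moreover have "common x w = real s * (2 * real t + 1)"
      using twin[OF that] card_N_real[OF x] by (simp add: common_def)
    ultimately have "real s * real t * E x w = real s * real t * 1"
      using common_adj[of w x] by (simp add: algebra_simps)
    then show ?thesis using st_pos by (simp only: mult_cancel_left) auto
  qed
  have TN: "T \<subseteq> N x" using un by (auto simp: T_def)
  have "(\<Sum>z\<in>N x. (E x z)\<^sup>2) = (\<Sum>z\<in>V. (E x z)\<^sup>2)"
    using NV finite_V E_nonadj[OF x] by (intro sum.mono_neutral_left) auto
  then have "(\<Sum>z\<in>N x. (E x z)\<^sup>2) = real s" using sum_E_sq[OF x] by simp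
  moreover have "(\<Sum>z\<in>N x. (E x z)\<^sup>2) = (\<Sum>z\<in>N x - T. (E x z)\<^sup>2) + (\<Sum>z\<in>T. (E x z)\<^sup>2)"
    by (rule sum.subset_diff[OF TN finN])
  ultimately have sum_E: "(\<Sum>z\<in>N x - T. (E x z)\<^sup>2) + real (card T) = real s"
    by (simp add: E_T)
  \<comment> \<open>Since \<open>E\<close> is 1 on \<open>T\<close>, this sum is the integer
    \<open>s - card T\<close>. It is at most \<open>4 s (2 t + 1) / t^2 <= 12 s / t < 1\<close> by
    \<open>t >= 13 s\<close>, so it is 0, and \<open>E\<close> vanishes off
    \<open>T\<close>.\<close>
  have "(\<Sum>z\<in>N x - T. (E x z)\<^sup>2) < 1"
  proof -
    have "(real t)\<^sup>2 * (\<Sum>z\<in>N x - T. (E x z)\<^sup>2) = (\<Sum>z\<in>N x - T. (E x z)\<^sup>2 * (real t)\<^sup>2)"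
      by (simp add: sum_distrib_left mult.commute)
    also have "\<dots> \<le> (\<Sum>z\<in>N x - T. 4)" using E_small by (intro sum_mono) auto
    also have "\<dots> \<le> (\<Sum>z\<in>N x. 4)" using finN by (intro sum_mono2) auto
    also have "\<dots> = 4 * (real s * (2 * real t + 1))" using card_N_real[OF x] by simp
    also have "\<dots> \<le> real t * (12 * real s)"
    proof -
      have "real s \<le> real s * real t" using st s1 by linarith
      then show ?thesis by (simp add: algebra_simps)
    qed
    also have "\<dots> < real t * real t"
      using t_large(2) s1 st_pos by (intro mult_strict_left_mono) auto
    finally have "(real t)\<^sup>2 * (\<Sum>z\<in>N x - T. (E x z)\<^sup>2) < (real t)\<^sup>2 * 1"
      by (simp add: power2_eq_square)
    then show ?thesis using st_pos by (subst (asm) mult_less_cancel_left_pos) auto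
  qed
  then have "real (card T) > real s - 1" using sum_E by linarith
  then have cT: "card T = s" using T_le by linarith
  then have "(\<Sum>z\<in>N x - T. (E x z)\<^sup>2) = 0" using sum_E by simp
  then have E0: "E x z = 0" if "z \<in> N x - T" for z
    using that finN by (subst (asm) sum_nonneg_eq_0_iff) auto
  have cKK: "card K1 = s * (t + 1)" "card K2 = s * (t + 1)"
    using cards le cT by (auto simp: algebra_simps)
  have card_line: "card (N x \<inter> N z) = s * (t + 1)" if "z \<in> N x - T" for z
  proof -
    have "common x z = real (s * (t + 1))" using common_adj[of z x] E0[OF that] that by (simp add: algebra_simps)
    then show ?thesis unfolding common_def by (simp only: of_nat_eq_iff)
  qed
  have side1: "\<forall>z\<in>K1 - K2. N x \<inter> N z = K1"
  proof
    fix z assume z: "z \<in> K1 - K2"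
    have "z \<in> K1" "z \<in> N x - T" using z un by (auto simp: T_def)
    then show "N x \<inter> N z = K1"
      using card_subset_eq[of "N x \<inter> N z" K1] Kadj[of z] card_line[of z] cKK finN by simp
  qed
  have side2: "\<forall>z\<in>K2 - K1. N x \<inter> N z = K2"
  proof
    fix z assume z: "z \<in> K2 - K1"
    have "z \<in> K2" "z \<in> N x - T" using z un by (auto simp: T_def)
    then show "N x \<inter> N z = K2"
      using card_subset_eq[of "N x \<inter> N z" K2] Kadj2[of z] card_line[of z] cKK finN by simp
  qed
  have "\<forall>w\<in>K1 \<inter> K2. N w = N x" using twin by (simp add: T_def)
  then show thesis
    by (rule that[OF un cKK cT[unfolded T_def] xK _ side1 side2])
qed

section \<open>Lines and coordinates\<close>

text \<open>The cliques attaining \<open>clique_card_le\<close>. In the clique extension of the grid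
  they are the rows and columns with every point replaced by its \<open>s\<close> twins.\<close>

definition line :: "'a set \<Rightarrow> bool" where
  "line L \<longleftrightarrow> clique L \<and> card L = s * (t + 1)"

lemma line_subset: "line L \<Longrightarrow> L \<subseteq> V"
  by (simp add: line_def clique_def)

lemma line_adj: "line L \<Longrightarrow> x \<in> L \<Longrightarrow> L \<subseteq> N x"
  by (simp add: line_def clique_def)

lemma finite_line: "line L \<Longrightarrow> finite L"
  using line_subset finite_V finite_subset by blast

lemma line_eqI: "line L \<Longrightarrow> line M \<Longrightarrow> L \<subseteq> M \<Longrightarrow> L = M"
  using card_subset_eq[OF finite_line, of M L] by (simp add: line_def)

text \<open>The two cliques of \<open>local_structure\<close> are the only lines at
  \<open>x\<close>: a line not inside \<open>L\<close> has a point \<open>z\<close> in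
  \<open>M - L\<close>, so it lies in \<open>N x\<close> and \<open>N z\<close>, whose intersection
  is \<open>M\<close>.\<close>

lemma lines_through:
  assumes x: "x \<in> V"
  obtains L M where "line L" "line M" "L \<noteq> M" "x \<in> L" "x \<in> M" "N x = L \<union> M" "card (L \<inter> M) = s"
    "\<forall>K. line K \<longrightarrow> x \<in> K \<longrightarrow> K = L \<or> K = M"
    "\<forall>a\<in>L - M. \<forall>b\<in>M - L. b \<notin> N a"
proof -
  obtain L M where LM: "L \<union> M = N x" "card L = s * (t + 1)" "card M = s * (t + 1)"
      "card (L \<inter> M) = s" "x \<in> L" "x \<in> M" "\<forall>w\<in>L \<inter> M. N w = N x"
      "\<forall>z\<in>L - M. N x \<inter> N z = L" "\<forall>z\<in>M - L. N x \<inter> N z = M"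
    by (rule local_structure[OF x])
  have "L \<subseteq> N z" if "z \<in> L" for z
    using LM(1,7,8) that by blast
  moreover have "M \<subseteq> N z" if "z \<in> M" for z
    using LM(1,7,9) that by blast
  ultimately have lines: "line L" "line M"
    using LM(1-3) N_subset[OF x] by (auto simp: line_def clique_def)
  have neq: "L \<noteq> M"
    using LM(2,4) s_pos t_large by auto
  have "K = L \<or> K = M" if K: "line K" "x \<in> K" for K
  proof (cases "K \<subseteq> L")
    case True
    then show ?thesis using line_eqI lines K by blast
  next
    case False
    then obtain z where z: "z \<in> K" "z \<notin> L" by blast
    then have "z \<in> M - L" using line_adj[OF K] LM(1) by blast
    then have "K \<subseteq> M" using LM(9) line_adj[OF K] line_adj[OF K(1) z(1)] by blast
    then show ?thesis using line_eqI lines K by blast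
  qed
  then have only: "\<forall>K. line K \<longrightarrow> x \<in> K \<longrightarrow> K = L \<or> K = M" by blast
  have "\<forall>a\<in>L - M. \<forall>b\<in>M - L. b \<notin> N a"
    using LM(1,8) by blast
  then show thesis
    by (rule that[OF lines neq LM(5,6) LM(1)[symmetric] LM(4) only])
qed

lemma two_lines:
  assumes "x \<in> V"
  obtains L M where "line L" "line M" "L \<noteq> M" "x \<in> L" "x \<in> M"
  using assms by (rule lines_through)

text \<open>Two distinct lines through \<open>x\<close> must be the pair given by
  \<open>lines_through\<close>, whose properties thus hold for any such choice.\<close>

lemma
  assumes "line L" "line M" "L \<noteq> M" "x \<in> L" "x \<in> M"
  shows card_Int_lines: "card (L \<inter> M) = s"
    and N_eq_lines: "N x = L \<union> M"
    and line_cases: "line K \<Longrightarrow> x \<in> K \<Longrightarrow> K = L \<or> K = M"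
    and lines_nonadj: "a \<in> L - M \<Longrightarrow> b \<in> M - L \<Longrightarrow> b \<notin> N a"
proof -
  have x: "x \<in> V" using assms line_subset by blast
  obtain A B where AB: "line A" "line B" "A \<noteq> B" "x \<in> A" "x \<in> B" "N x = A \<union> B" "card (A \<inter> B) = s"
    "\<forall>K. line K \<longrightarrow> x \<in> K \<longrightarrow> K = A \<or> K = B"
    "\<forall>a\<in>A - B. \<forall>b\<in>B - A. b \<notin> N a"
    by (rule lines_through[OF x])
  have eq: "L = A \<and> M = B \<or> L = B \<and> M = A"
    using AB(8) assms by blast
  then show "card (L \<inter> M) = s" "N x = L \<union> M"
    using AB(6,7) by (auto simp: Int_commute)
  show "line K \<Longrightarrow> x \<in> K \<Longrightarrow> K = L \<or> K = M"
    using AB(8) eq by blast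
  show "b \<notin> N a" if "a \<in> L - M" "b \<in> M - L"
  proof -
    have "a \<in> V" "b \<in> V" using that assms line_subset by blast+
    then show ?thesis using AB(9) eq that N_sym_iff by blast
  qed
qed

text \<open>A point of \<open>C\<close> on both \<open>L\<close> and \<open>M\<close> would force
  \<open>C\<close> to be one of them and so contain \<open>y\<close>. Hence points where
  \<open>C\<close> meets \<open>L\<close> and \<open>M\<close> lie in \<open>L - M\<close> and
  \<open>M - L\<close>, yet they are adjacent within \<open>C\<close>.\<close>

lemma no_triangle:
  assumes lines: "line L" "line M" "L \<noteq> M" "y \<in> L" "y \<in> M" and C: "line C" "y \<notin> C"
  shows "C \<inter> L = {} \<or> C \<inter> M = {}"
proof (rule ccontr)
  assume "\<not> ?thesis"
  then obtain a b where ab: "a \<in> C" "a \<in> L" "b \<in> C" "b \<in> M" by blast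
  have not_both: "w \<notin> L \<inter> M" if "w \<in> C" for w
    using line_cases[OF lines(1-3) _ _ C(1), of w] that lines(4,5) C(2) by blast
  have "a \<in> L - M" "b \<in> M - L" using ab not_both by auto
  moreover have "b \<in> N a" using line_adj[OF C(1)] ab by auto
  ultimately show False using lines_nonadj[OF lines] by blast
qed

text \<open>By the clique bound some \<open>x\<close> in \<open>C\<close> is not adjacent to
  \<open>y\<close>. If no line at \<open>y\<close> met \<open>C\<close>, all common neighbours of
  \<open>x\<close> and \<open>y\<close> would lie on the other line \<open>D\<close> at
  \<open>x\<close>. By \<open>no_triangle\<close> it meets at most one line at \<open>y\<close>,
  leaving at most \<open>s\<close> of the required \<open>2 s\<close>.\<close>

lemma line_through_meeting:
  assumes C: "line C" and y: "y \<in> V" "y \<notin> C"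
  obtains L where "line L" "y \<in> L" "L \<inter> C \<noteq> {}"
proof -
  obtain x where x: "x \<in> C" "x \<notin> N y"
  proof (rule ccontr)
    assume "\<not> thesis"
    then have "C \<subseteq> N y" using that by blast
    then have "clique (insert y C)"
      using C y N_refl[OF y(1)] N_sym[OF y(1)] by (auto simp: line_def clique_def)
    then have "card (insert y C) \<le> s * (t + 1)" by (rule clique_card_le)
    then show False using C y(2) finite_line[OF C] by (simp add: line_def)
  qed
  have xV: "x \<in> V" using C x line_subset by blast
  obtain A B where "line A" "line B" "A \<noteq> B" "x \<in> A" "x \<in> B"
    by (rule two_lines[OF xV])
  then obtain D where D: "line D" "D \<noteq> C" "x \<in> D" by metis
  have NxCD: "N x = C \<union> D" using N_eq_lines[OF C D(1)] D x by blast
  obtain L M where LM: "line L" "line M" "L \<noteq> M" "y \<in> L" "y \<in> M"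
    by (rule two_lines[OF y(1)])
  have NyLM: "N y = L \<union> M" by (rule N_eq_lines[OF LM])
  have xy: "y \<notin> N x" using x y xV N_sym_iff by blast
  then have yD: "y \<notin> D" using NxCD by blast
  have "L \<inter> C \<noteq> {} \<or> M \<inter> C \<noteq> {}"
  proof (rule ccontr)
    assume disj: "\<not> ?thesis"
    then have eq: "N x \<inter> N y = D \<inter> L \<union> D \<inter> M" using NxCD NyLM by blast
    have le: "card (D \<inter> K) \<le> s" if "line K" "y \<in> K" for K
    proof (cases "D \<inter> K = {}")
      case False
      then show ?thesis using card_Int_lines[OF D(1) that(1)] that yD by auto
    qed simp
    have "card (N x \<inter> N y) \<le> s"
      using no_triangle[OF LM(1-5) D(1) yD] le[OF LM(1,4)] le[OF LM(2,5)] unfolding eq by auto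
    then show False using card_common[OF xV y(1) xy] s_pos by simp
  qed
  then show thesis using that LM by blast
qed

text \<open>Rows are a fixed line \<open>C\<close> and the lines disjoint from it, columns are all
  other lines. The row of \<open>y\<close> is a line through each of its points \<open>z\<close>,
  hence the row or the column of \<open>z\<close>, and it is not a column.\<close>

lemma parallel_classes:
  obtains row col :: "'a \<Rightarrow> 'a set" where
    "\<forall>y\<in>V. line (row y) \<and> y \<in> row y" "\<forall>y\<in>V. line (col y) \<and> y \<in> col y"
    "\<forall>y\<in>V. N y = row y \<union> col y" "\<forall>y\<in>V. card (row y \<inter> col y) = s"
    "\<forall>y\<in>V. \<forall>z\<in>row y. row z = row y" "\<forall>y\<in>V. \<forall>z\<in>col y. col z = col y"
proof -
  have "card V \<noteq> 0" using s_pos by (simp add: card_V)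
  then obtain x where x: "x \<in> V" by force
  obtain C where C: "line C" by (rule two_lines[OF x])
  \<comment> \<open>By \<open>no_triangle\<close> and \<open>line_through_meeting\<close>, each vertex outside \<open>C\<close> lies on exactly one line
    meeting \<open>C\<close>.\<close>
  define is_row where "is_row L \<longleftrightarrow> line L \<and> (L = C \<or> L \<inter> C = {})" for L
  define is_col where "is_col L \<longleftrightarrow> line L \<and> \<not> (L = C \<or> L \<inter> C = {})" for L
  have ex: "\<exists>L M. is_row L \<and> is_col M \<and> y \<in> L \<and> y \<in> M" if y: "y \<in> V" for y
  proof -
    obtain A B where AB: "line A" "line B" "A \<noteq> B" "y \<in> A" "y \<in> B"
      by (rule two_lines[OF y])
    show ?thesis
    proof (cases "y \<in> C")
      case True
      then show ?thesis using AB C unfolding is_row_def is_col_def by blast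
    next
      case False
      then obtain L where L: "line L" "y \<in> L" "L \<inter> C \<noteq> {}"
        by (rule line_through_meeting[OF C y])
      obtain M where M: "line M" "y \<in> M" "L \<noteq> M" using AB L by blast
      have "M \<inter> C = {}" using no_triangle[OF L(1) M(1) M(3) L(2) M(2) C False] L by blast
      then show ?thesis using L M False unfolding is_row_def is_col_def by blast
    qed
  qed
  then obtain row col where
    rc: "\<And>y. y \<in> V \<Longrightarrow> is_row (row y) \<and> is_col (col y) \<and> y \<in> row y \<and> y \<in> col y"
    by metis
  have lines: "line (row y)" "line (col y)" "row y \<noteq> col y" "y \<in> row y" "y \<in> col y" if "y \<in> V" for y
    using rc[OF that] by (auto simp: is_row_def is_col_def)
  have row_neq_col: "row y \<noteq> col z" if "y \<in> V" "z \<in> V" for y z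
    using rc[OF that(1)] rc[OF that(2)] by (auto simp: is_row_def is_col_def)
  have cases: "K = row y \<or> K = col y" if "line K" "y \<in> K" for K y
  proof -
    have y: "y \<in> V" using that line_subset by blast
    show ?thesis by (rule line_cases[OF lines[OF y] that])
  qed
  have row_eq: "\<forall>y\<in>V. \<forall>z\<in>row y. row z = row y"
  proof (intro ballI)
    fix y z assume yz: "y \<in> V" "z \<in> row y"
    then have z: "z \<in> V" using lines(1) line_subset by blast
    show "row z = row y"
      using cases[OF lines(1)[OF yz(1)] yz(2)] row_neq_col[OF yz(1) z] by simp
  qed
  have col_eq: "\<forall>y\<in>V. \<forall>z\<in>col y. col z = col y"
  proof (intro ballI)
    fix y z assume yz: "y \<in> V" "z \<in> col y"
    then have z: "z \<in> V" using lines(2) line_subset by blast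
    show "col z = col y"
      using cases[OF lines(2)[OF yz(1)] yz(2)] row_neq_col[OF z yz(1)] by simp
  qed
  show thesis
  proof (rule that[OF _ _ _ _ row_eq col_eq])
    show "\<forall>y\<in>V. N y = row y \<union> col y" "\<forall>y\<in>V. card (row y \<inter> col y) = s"
      by (intro ballI N_eq_lines[OF lines] card_Int_lines[OF lines]; assumption)+
    show "\<forall>y\<in>V. line (row y) \<and> y \<in> row y" "\<forall>y\<in>V. line (col y) \<and> y \<in> col y"
      by (intro ballI conjI lines; assumption)+
  qed
qed

text \<open>A class partitions the \<open>s (t + 1)^2\<close> vertices into blocks of size
  \<open>s (t + 1)\<close>.\<close>

lemma card_parallel_class:
  assumes l: "\<forall>y\<in>V. line (l y) \<and> y \<in> l y"
    and eq: "\<forall>y\<in>V. \<forall>z\<in>l y. l z = l y"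
  shows "card (l ` V) = t + 1"
proof -
  have V: "\<Union> (l ` V) = V" using l line_subset by blast
  have "s * (t + 1) * card (l ` V) = card (\<Union> (l ` V))"
  proof (rule card_partition)
    show "finite (l ` V)" "finite (\<Union> (l ` V))" unfolding V using finite_V by auto
    show "card c = s * (t + 1)" if "c \<in> l ` V" for c using that l by (auto simp: line_def)
    show "c \<inter> d = {}" if "c \<in> l ` V" "d \<in> l ` V" "c \<noteq> d" for c d
      using that eq by (metis disjoint_iff imageE)
  qed
  then have "s * (t + 1) * card (l ` V) = s * (t + 1) * (t + 1)"
    unfolding V card_V power2_eq_square by (simp only: mult.assoc)
  then show ?thesis using s_pos by (subst (asm) mult_left_cancel) auto
qed

text \<open>Row and column give the grid point, and a numbering of their \<open>s\<close> common
  vertices gives the position in its clique. Surjectivity follows from injectivity by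
  counting.\<close>

lemma grid_coordinates:
  obtains f :: "'a \<Rightarrow> (nat \<times> nat) \<times> nat" where
    "bij_betw f V (({..<t + 1} \<times> {..<t + 1}) \<times> {..<s})"
    "\<And>x y. x \<in> V \<Longrightarrow> y \<in> V \<Longrightarrow> y \<in> N x \<longleftrightarrow>
      fst (fst (f x)) = fst (fst (f y)) \<or> snd (fst (f x)) = snd (fst (f y))"
proof -
  obtain row col where
    rc: "\<forall>y\<in>V. line (row y) \<and> y \<in> row y" "\<forall>y\<in>V. line (col y) \<and> y \<in> col y"
      "\<forall>y\<in>V. N y = row y \<union> col y" "\<forall>y\<in>V. card (row y \<inter> col y) = s"
      "\<forall>y\<in>V. \<forall>z\<in>row y. row z = row y" "\<forall>y\<in>V. \<forall>z\<in>col y. col z = col y"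
    by (rule parallel_classes)
  have "card (row ` V) = t + 1" "card (col ` V) = t + 1"
    by (rule card_parallel_class[OF rc(1,5)], rule card_parallel_class[OF rc(2,6)])
  then obtain \<alpha> \<beta> where \<alpha>: "bij_betw \<alpha> (row ` V) {..<t + 1}" and \<beta>: "bij_betw \<beta> (col ` V) {..<t + 1}"
    using finite_same_card_bij[of "row ` V" "{..<t + 1}"] finite_same_card_bij[of "col ` V" "{..<t + 1}"]
      finite_V by auto
  \<comment> \<open>The numbering is chosen per block and not per vertex, so that twins share one
    numbering.\<close>
  define \<gamma> :: "'a set \<Rightarrow> 'a \<Rightarrow> nat" where "\<gamma> A = (SOME g. bij_betw g A {..<s})" for A
  have ex_bij: "\<exists>g. bij_betw g (row y \<inter> col y) {..<s}" if "y \<in> V" for y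
    using finite_same_card_bij[of "row y \<inter> col y" "{..<s}"] rc(1,4) finite_line that by auto
  have \<gamma>: "bij_betw (\<gamma> (row y \<inter> col y)) (row y \<inter> col y) {..<s}" if "y \<in> V" for y
    unfolding \<gamma>_def by (rule someI_ex[OF ex_bij[OF that]])
  define f where "f y = ((\<alpha> (row y), \<beta> (col y)), \<gamma> (row y \<inter> col y) y)" for y
  have \<alpha>_eq: "\<alpha> (row x) = \<alpha> (row y) \<longleftrightarrow> row x = row y" if "x \<in> V" "y \<in> V" for x y
    using \<alpha> that by (auto simp: bij_betw_def inj_on_def)
  have \<beta>_eq: "\<beta> (col x) = \<beta> (col y) \<longleftrightarrow> col x = col y" if "x \<in> V" "y \<in> V" for x y
    using \<beta> that by (auto simp: bij_betw_def inj_on_def)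
  have inj: "inj_on f V"
  proof (rule inj_onI)
    fix x y assume xy: "x \<in> V" "y \<in> V" "f x = f y"
    then have eq: "row x = row y" "col x = col y" using \<alpha>_eq \<beta>_eq by (auto simp: f_def)
    then have "\<gamma> (row y \<inter> col y) x = \<gamma> (row y \<inter> col y) y" using xy by (simp add: f_def)
    moreover have "x \<in> row y \<inter> col y" "y \<in> row y \<inter> col y" using rc(1,2) xy eq by auto
    ultimately show "x = y" using \<gamma>[OF xy(2)] by (auto simp: bij_betw_def inj_on_def)
  qed
  have sub: "f ` V \<subseteq> ({..<t + 1} \<times> {..<t + 1}) \<times> {..<s}"
  proof
    fix p assume "p \<in> f ` V"
    then obtain y where y: "y \<in> V" "p = f y" by blast
    have "\<alpha> (row y) \<in> {..<t + 1}" "\<beta> (col y) \<in> {..<t + 1}" "\<gamma> (row y \<inter> col y) y \<in> {..<s}"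
      using bij_betwE[OF \<alpha>] bij_betwE[OF \<beta>] bij_betwE[OF \<gamma>[OF y(1)]] rc(1,2) y by auto
    then show "p \<in> ({..<t + 1} \<times> {..<t + 1}) \<times> {..<s}" by (simp add: y f_def)
  qed
  have "f ` V = ({..<t + 1} \<times> {..<t + 1}) \<times> {..<s}"
    using sub by (rule card_subset_eq[rotated])
      (simp_all add: card_image[OF inj] card_V card_cartesian_product power2_eq_square)
  then have "bij_betw f V (({..<t + 1} \<times> {..<t + 1}) \<times> {..<s})"
    using inj by (simp add: bij_betw_def)
  moreover have "y \<in> N x \<longleftrightarrow> row x = row y \<or> col x = col y" if xy: "x \<in> V" "y \<in> V" for x y
  proof -
    have "y \<in> row x \<longleftrightarrow> row x = row y" using rc(1,5) xy by metis
    moreover have "y \<in> col x \<longleftrightarrow> col x = col y" using rc(2,6) xy by metis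
    ultimately show ?thesis using bspec[OF rc(3) xy(1)] by simp
  qed
  ultimately show thesis
    using that[of f] \<alpha>_eq \<beta>_eq by (simp add: f_def)
qed

end

section \<open>From the spectrum to the grid\<close>

text \<open>The trace of \<open>B^2\<close> gives the degree and that of \<open>B^3\<close> gives
  \<mu>. The trace of the square of \<open>B(B - st)(B + s)\<close> gives the cubic
  identity.\<close>

lemma grid_spectrum_of_traces:
  fixes V :: "'a set" and N :: "'a \<Rightarrow> 'a set" and s t \<kappa> \<mu> :: nat
  defines "M \<equiv> \<lambda>x y. of_bool (y \<in> N x) - of_bool (x = y) :: real"
  assumes finite_V: "finite V"
    and N_subset: "\<And>x. x \<in> V \<Longrightarrow> N x \<subseteq> V"
    and N_refl: "\<And>x. x \<in> V \<Longrightarrow> x \<in> N x"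
    and N_sym: "\<And>x y. x \<in> V \<Longrightarrow> y \<in> N x \<Longrightarrow> x \<in> N y"
    and card_N: "\<And>x. x \<in> V \<Longrightarrow> card (N x) = \<kappa>"
    and card_common: "\<And>x y. x \<in> V \<Longrightarrow> y \<in> V \<Longrightarrow> y \<notin> N x \<Longrightarrow> card (N x \<inter> N y) = \<mu>"
    and s_pos: "s \<ge> 1" and t_large: "t \<ge> 250" "t \<ge> 13 * s"
    and trace: "\<And>as. (\<Sum>x\<in>V. shifted_product V M as x x) =
      (\<Prod>a\<leftarrow>as. real s * (2 * real t + 1) - 1 - a) + 2 * real t * (\<Prod>a\<leftarrow>as. real s * real t - 1 - a) +
      (real s - 1) * (real t + 1)\<^sup>2 * (\<Prod>a\<leftarrow>as. - 1 - a) + (real t)\<^sup>2 * (\<Prod>a\<leftarrow>as. - real s - 1 - a)"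
  shows "grid_spectrum V N s t"
proof -
  note shifted_product.simps(2)[simp del]
  define b where "b x y = (of_bool (y \<in> N x) :: real)" for x y
  define m where "m x y = real (card (N x \<inter> N y))" for x y
  define m3 where "m3 x y = (\<Sum>z\<in>N x. m z y)" for x y
  let ?W = "shifted_product V M"
  let ?\<delta> = "\<lambda>x y. of_bool (x = y) :: real"
  have N_sym_iff: "y \<in> N x \<longleftrightarrow> x \<in> N y" if "x \<in> V" "y \<in> V" for x y
    using N_sym that by blast
  have finite_N: "finite (N x)" if "x \<in> V" for x
    using N_subset[OF that] finite_V finite_subset by blast
  have sum_b: "(\<Sum>z\<in>V. b x z * f z) = (\<Sum>z\<in>N x. f z)" if "x \<in> V" for f x
    using N_subset[OF that] finite_V unfolding b_def by (intro sum.mono_neutral_cong_right) auto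
  have sum_\<delta>: "(\<Sum>z\<in>V. ?\<delta> x z * f z) = f x" if "x \<in> V" for f x
  proof -
    have "(\<Sum>z\<in>V. ?\<delta> x z * f z) = (\<Sum>z\<in>{x}. ?\<delta> x z * f z)"
      using finite_V that by (intro sum.mono_neutral_right) auto
    then show ?thesis by simp
  qed
  have W_Cons: "?W (a # as) x y = (\<Sum>z\<in>N x. ?W as z y) - (a + 1) * ?W as x y" if "x \<in> V" for a as x y
  proof -
    have "?W (a # as) x y = (\<Sum>z\<in>V. b x z * ?W as z y - (a + 1) * (?\<delta> x z * ?W as z y))"
      by (simp add: shifted_product.simps(2) M_def b_def algebra_simps)
    also have "\<dots> = (\<Sum>z\<in>V. b x z * ?W as z y) - (a + 1) * (\<Sum>z\<in>V. ?\<delta> x z * ?W as z y)"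
      by (simp only: sum_subtractf sum_distrib_left)
    finally show ?thesis by (simp only: sum_b[OF that] sum_\<delta>[OF that])
  qed
  have sum_N_\<delta>: "(\<Sum>z\<in>N x. ?\<delta> z y) = b x y" if "x \<in> V" for x y
    using finite_N[OF that] by (simp add: b_def of_bool_def sum.delta)
  have sum_N_b: "(\<Sum>z\<in>N x. b z y) = m x y" if "x \<in> V" "y \<in> V" for x y
  proof -
    have "(\<Sum>z\<in>N x. b z y) = (\<Sum>z\<in>N x. of_bool (z \<in> N x \<inter> N y))"
      using N_sym_iff[OF that(2)] N_subset[OF that(1)] unfolding b_def by (intro sum.cong) auto
    also have "\<dots> = (\<Sum>z\<in>N x \<inter> N y. 1)"
      using finite_N[OF that(1)] by (intro sum.mono_neutral_cong_right) auto
    finally show ?thesis by (simp add: m_def)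
  qed
  \<comment> \<open>As \<open>M\<close> is the adjacency matrix, the shift by \<open>-1\<close>
    yields \<open>B\<close>, so lists of \<open>-1\<close> are powers of \<open>B\<close>.\<close>
  have W1: "?W [-1] x y = b x y" if "x \<in> V" for x y
    using W_Cons[OF that, of "-1" "[]"] sum_N_\<delta>[OF that] by simp
  have W2: "?W [-1, -1] x y = m x y" if "x \<in> V" "y \<in> V" for x y
  proof -
    have "?W [-1, -1] x y = (\<Sum>z\<in>N x. ?W [-1] z y)"
      using W_Cons[OF that(1), of "-1" "[-1]"] by simp
    also have "\<dots> = (\<Sum>z\<in>N x. b z y)"
      using N_subset[OF that(1)] by (intro sum.cong refl W1) auto
    finally show ?thesis using sum_N_b[OF that] by simp
  qed
  have W3: "?W [-1, -1, -1] x y = m3 x y" if "x \<in> V" "y \<in> V" for x y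
  proof -
    have "?W [-1, -1, -1] x y = (\<Sum>z\<in>N x. ?W [-1, -1] z y)"
      using W_Cons[OF that(1), of "-1" "[-1, -1]"] by simp
    also have "\<dots> = (\<Sum>z\<in>N x. m z y)"
      using N_subset[OF that(1)] that by (intro sum.cong refl W2) auto
    finally show ?thesis by (simp add: m3_def)
  qed
  \<comment> \<open>The empty list gives the trace of the identity.\<close>
  have n: "real (card V) = real s * (real t + 1)\<^sup>2"
    using trace[of "[]"] by (simp add: power2_eq_square algebra_simps)
  have s0: "real s > 0" and t0: "real t > 0" using s_pos t_large by auto
  have n_pos: "real (card V) > 0" unfolding n using s0 t0 by simp
  have "(\<Sum>x\<in>V. ?W [-1, -1] x x) = (\<Sum>x\<in>V. real \<kappa>)"
    by (intro sum.cong refl) (simp add: W2 m_def card_N)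
  then have "real (card V) * real \<kappa> =
      (real s * (2 * real t + 1))\<^sup>2 + 2 * real t * (real s * real t)\<^sup>2 + (real t)\<^sup>2 * (real s)\<^sup>2"
    unfolding trace by (simp add: power2_eq_square)
  also have "\<dots> = real (card V) * (real s * (2 * real t + 1))"
    unfolding n by (simp add: power2_eq_square algebra_simps)
  finally have "real (card V) * real \<kappa> = real (card V) * (real s * (2 * real t + 1))" .
  then have \<kappa>: "real \<kappa> = real s * (2 * real t + 1)" using n_pos by simp
  have rb: "(\<Sum>y\<in>V. b x y) = real \<kappa>" if "x \<in> V" for x
    using sum_b[OF that, of "\<lambda>_. 1"] card_N[OF that] by simp
  have m_sum: "m x y = (\<Sum>z\<in>V. b x z * b z y)" if "x \<in> V" "y \<in> V" for x y
    using sum_N_b[OF that] sum_b[OF that(1), of "\<lambda>z. b z y"] by simp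
  have rm: "(\<Sum>y\<in>V. m x y) = (real \<kappa>)\<^sup>2" if "x \<in> V" for x
  proof -
    have "(\<Sum>y\<in>V. m x y) = (\<Sum>y\<in>V. \<Sum>z\<in>V. b x z * b z y)"
      using that by (intro sum.cong refl m_sum)
    also have "\<dots> = (\<Sum>z\<in>V. b x z * (\<Sum>y\<in>V. b z y))"
      by (subst sum.swap) (simp add: sum_distrib_left)
    also have "\<dots> = (\<Sum>z\<in>V. b x z * real \<kappa>)" by (intro sum.cong refl) (simp add: rb)
    also have "\<dots> = (real \<kappa>)\<^sup>2"
      using rb[OF that] by (simp add: sum_distrib_right[symmetric] power2_eq_square)
    finally show ?thesis .
  qed
  have m3_sum: "m3 x y = (\<Sum>z\<in>V. b x z * m z y)" if "x \<in> V" for x y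
    unfolding m3_def using sum_b[OF that] by simp
  have rm3: "(\<Sum>y\<in>V. m3 x y) = real \<kappa> ^ 3" if "x \<in> V" for x
  proof -
    have "(\<Sum>y\<in>V. m3 x y) = (\<Sum>z\<in>V. b x z * (\<Sum>y\<in>V. m z y))"
      unfolding m3_sum[OF that] by (subst sum.swap) (simp add: sum_distrib_left)
    also have "\<dots> = (\<Sum>z\<in>V. b x z * (real \<kappa>)\<^sup>2)" by (intro sum.cong refl) (simp add: rm)
    also have "\<dots> = real \<kappa> ^ 3"
      using rb[OF that] by (simp add: sum_distrib_right[symmetric] power2_eq_square power3_eq_cube)
    finally show ?thesis .
  qed
  have m_sym: "m x y = m y x" for x y by (simp add: m_def Int_commute)
  have m3_sym: "m3 x y = m3 y x" if "x \<in> V" "y \<in> V" for x y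
  proof -
    have "m3 x y = (\<Sum>z\<in>V. b x z * m y z)"
      unfolding m3_sum[OF that(1)] by (simp add: m_sym)
    also have "\<dots> = (\<Sum>z\<in>V. \<Sum>w\<in>V. b x z * (b y w * b w z))"
      unfolding sum_distrib_left[symmetric] using that by (intro sum.cong refl) (simp add: m_sum)
    also have "\<dots> = (\<Sum>w\<in>V. \<Sum>z\<in>V. b y w * (b x z * b z w))"
      using N_sym_iff by (subst sum.swap, intro sum.cong refl) (simp add: b_def)
    also have "\<dots> = (\<Sum>w\<in>V. b y w * m x w)"
      unfolding sum_distrib_left[symmetric] using that by (intro sum.cong refl) (simp add: m_sum)
    also have "\<dots> = m3 y x" unfolding m3_sum[OF that(2)] by (simp add: m_sym)
    finally show ?thesis .
  qed

  \<comment> \<open>A row sum of \<open>B^2\<close> splits into the diagonal entry of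
    \<open>B^3\<close>, from \<open>N x\<close>, and \<mu> for each nonneighbour.\<close>
  have "(\<Sum>y\<in>V. m x y) = m3 x x + (real (card V) - real \<kappa>) * real \<mu>" if "x \<in> V" for x
  proof -
    have "(\<Sum>y\<in>V. m x y) = (\<Sum>y\<in>V - N x. m x y) + (\<Sum>y\<in>N x. m x y)"
      by (rule sum.subset_diff[OF N_subset[OF that] finite_V])
    also have "(\<Sum>y\<in>V - N x. m x y) = (\<Sum>y\<in>V - N x. real \<mu>)"
      using that by (intro sum.cong refl) (simp add: m_def card_common)
    also have "\<dots> = (real (card V) - real \<kappa>) * real \<mu>"
      using card_Diff_subset[OF finite_N[OF that] N_subset[OF that]] card_N[OF that]
        card_mono[OF finite_V N_subset[OF that]] by (simp add: of_nat_diff)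
    finally show ?thesis by (simp add: m3_def m_sym)
  qed
  then have "(\<Sum>x\<in>V. (real \<kappa>)\<^sup>2) = (\<Sum>x\<in>V. m3 x x + (real (card V) - real \<kappa>) * real \<mu>)"
    using rm by (intro sum.cong refl) simp
  also have "\<dots> = (\<Sum>x\<in>V. ?W [-1, -1, -1] x x) + real (card V) * ((real (card V) - real \<kappa>) * real \<mu>)"
    by (simp add: sum.distrib W3)
  finally have "real s * (real t + 1)\<^sup>2 * (real s * (2 * real t + 1))\<^sup>2 =
      (real s * (2 * real t + 1)) ^ 3 + 2 * real t * (real s * real t) ^ 3 - (real t)\<^sup>2 * real s ^ 3
      + real s * (real t + 1)\<^sup>2 * ((real s * (real t + 1)\<^sup>2 - real s * (2 * real t + 1)) * real \<mu>)"
    unfolding trace \<kappa> n by (simp add: n power3_eq_cube)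
  then have "(real s)\<^sup>2 * (real t)\<^sup>2 * (real t + 1)\<^sup>2 * real \<mu> = (real s)\<^sup>2 * (real t)\<^sup>2 * (real t + 1)\<^sup>2 * (2 * real s)"
    by (simp add: power2_eq_square power3_eq_cube algebra_simps)
  then have "real \<mu> = 2 * real s" using s0 t0 by simp
  then have \<mu>: "\<mu> = 2 * s" by linarith

  define c where "c = 2 * (real s)\<^sup>2 * (2 * real t + 1)"
  \<comment> \<open>The roots of \<open>B(B - st)(B + s)\<close>, lowered by 1 because the shifts
    apply to \<open>B - I\<close>.\<close>
  define q where "q = [- 1, real s * real t - 1, - real s - 1]"
  define C where "C x y = m3 x y - real s * (real t - 1) * m x y - (real s)\<^sup>2 * real t * b x y" for x y
  have Wq1: "?W [- real s - 1] x y = b x y + real s * ?\<delta> x y" if "x \<in> V" for x y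
    using W_Cons[OF that, of "- real s - 1" "[]"] sum_N_\<delta>[OF that] by simp
  have Wq2: "?W [real s * real t - 1, - real s - 1] x y =
      m x y - real s * (real t - 1) * b x y - (real s)\<^sup>2 * real t * ?\<delta> x y" if "x \<in> V" "y \<in> V" for x y
  proof -
    have "(\<Sum>z\<in>N x. ?W [- real s - 1] z y) = (\<Sum>z\<in>N x. b z y + real s * ?\<delta> z y)"
      using N_subset[OF that(1)] by (intro sum.cong refl Wq1) auto
    also have "\<dots> = m x y + real s * b x y"
      using sum_N_b[OF that] sum_N_\<delta>[OF that(1)] by (simp only: sum.distrib sum_distrib_left[symmetric])
    finally show ?thesis
      unfolding W_Cons[OF that(1), of _ "[- real s - 1]"] Wq1[OF that(1)]
      by (simp add: power2_eq_square algebra_simps)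
  qed
  have Wq: "?W q x y = C x y" if "x \<in> V" "y \<in> V" for x y
  proof -
    have "(\<Sum>z\<in>N x. ?W [real s * real t - 1, - real s - 1] z y) =
        (\<Sum>z\<in>N x. m z y - real s * (real t - 1) * b z y - (real s)\<^sup>2 * real t * ?\<delta> z y)"
      using N_subset[OF that(1)] that by (intro sum.cong refl Wq2) auto
    also have "\<dots> = C x y"
      using sum_N_b[OF that] sum_N_\<delta>[OF that(1)]
      by (simp only: sum_subtractf sum_distrib_left[symmetric] C_def m3_def)
    finally show ?thesis
      unfolding q_def W_Cons[OF that(1), of _ "[real s * real t - 1, - real s - 1]"] by simp
  qed
  have cn: "real \<kappa> ^ 3 - real s * (real t - 1) * (real \<kappa>)\<^sup>2 - (real s)\<^sup>2 * real t * real \<kappa> = c * real (card V)"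
    unfolding \<kappa> n c_def by (simp add: power2_eq_square power3_eq_cube algebra_simps)
  have C_sym: "C x y = C y x" if "x \<in> V" "y \<in> V" for x y
    using m3_sym[OF that] m_sym[of x y] N_sym_iff[OF that] by (simp add: C_def b_def)
  have row_C: "(\<Sum>y\<in>V. C x y) = c * real (card V)" if "x \<in> V" for x
    unfolding C_def sum_subtractf sum_distrib_left[symmetric] rm3[OF that] rm[OF that] rb[OF that] cn ..
  \<comment> \<open>The symmetric matrix \<open>C - cJ\<close> vanishes because its square has trace \<open>0\<close>; this avoids
    diagonalising.\<close>
  have "(\<Sum>x\<in>V. \<Sum>y\<in>V. (C x y)\<^sup>2) = (\<Sum>x\<in>V. ?W (q @ q) x x)"
  proof (intro sum.cong refl)
    fix x assume x: "x \<in> V"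
    have "?W (q @ q) x x = (\<Sum>z\<in>V. ?W q x z * ?W q z x)"
      by (rule shifted_product_append[OF finite_V x x])
    also have "\<dots> = (\<Sum>z\<in>V. (C x z)\<^sup>2)"
      using x by (intro sum.cong refl) (simp add: Wq C_sym[of x] power2_eq_square)
    finally show "(\<Sum>y\<in>V. (C x y)\<^sup>2) = ?W (q @ q) x x" by simp
  qed
  \<comment> \<open>Only the largest eigenvalue survives \<open>q\<close>; its cubic value is
    \<open>c\<close> times the number of vertices, as \<open>cn\<close> records.\<close>
  also have "\<dots> = (c * real (card V))\<^sup>2"
    unfolding trace q_def c_def n by (simp add: power2_eq_square algebra_simps)
  finally have sq: "(\<Sum>x\<in>V. \<Sum>y\<in>V. (C x y)\<^sup>2) = (c * real (card V))\<^sup>2" .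
  have "(\<Sum>x\<in>V. \<Sum>y\<in>V. (C x y - c)\<^sup>2) =
      (\<Sum>x\<in>V. \<Sum>y\<in>V. (C x y)\<^sup>2) - 2 * c * (\<Sum>x\<in>V. \<Sum>y\<in>V. C x y) + (\<Sum>x\<in>V. \<Sum>y\<in>V. c\<^sup>2)"
    unfolding sum_distrib_left sum_subtractf[symmetric] sum.distrib[symmetric]
    by (intro sum.cong refl) (simp add: power2_eq_square algebra_simps)
  also have "\<dots> = 0"
    unfolding sq by (simp add: row_C power2_eq_square)
  finally have "(\<Sum>x\<in>V. \<Sum>y\<in>V. (C x y - c)\<^sup>2) = 0" .
  then have cubic: "C x y = c" if "x \<in> V" "y \<in> V" for x y
    using that finite_V by (simp add: sum_nonneg_eq_0_iff sum_nonneg)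
  show ?thesis
  proof
    show "card V = s * (t + 1)\<^sup>2"
    proof -
      have "real (card V) = real (s * (t + 1)\<^sup>2)" unfolding n by simp
      then show ?thesis by (simp only: of_nat_eq_iff)
    qed
    show "card (N x) = s * (2 * t + 1)" if "x \<in> V" for x
    proof -
      have "real (card (N x)) = real (s * (2 * t + 1))" using card_N[OF that] \<kappa> by (simp add: algebra_simps)
      then show ?thesis by (simp only: of_nat_eq_iff)
    qed
    show "card (N x \<inter> N y) = 2 * s" if "x \<in> V" "y \<in> V" "y \<notin> N x" for x y
      using card_common[OF that] \<mu> by simp
    show "(\<Sum>z\<in>N x. real (card (N z \<inter> N y))) =
      real s * (real t - 1) * real (card (N x \<inter> N y)) + (real s)\<^sup>2 * real t * of_bool (y \<in> N x) +
      2 * (real s)\<^sup>2 * (2 * real t + 1)" if "x \<in> V" "y \<in> V" for x y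
      using cubic[OF that] unfolding C_def c_def m3_def m_def b_def by linarith
  qed (fact finite_V N_subset N_refl N_sym s_pos t_large)+
qed

section \<open>The isomorphism with the clique extension\<close>

text \<open>Vertices of one clique share both coordinates, so the two cases of the extension merge
  into the condition used in \<open>grid_coordinates\<close>.\<close>

lemma arcs_clique_extension_grid:
  "(p, q) \<in> parcs (clique_extension s (with_proj (grid_graph n))) \<longleftrightarrow>
    p \<in> ({..<n} \<times> {..<n}) \<times> {..<s} \<and> q \<in> ({..<n} \<times> {..<n}) \<times> {..<s} \<and> p \<noteq> q \<and>
    (fst (fst p) = fst (fst q) \<or> snd (fst p) = snd (fst q))"
  by (cases p; cases q)
    (auto simp: clique_extension_def grid_graph_def cartesian_product_def complete_graph_def)

lemma verts_clique_extension_grid: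
  "pverts (clique_extension s (with_proj (grid_graph n))) = ({..<n} \<times> {..<n}) \<times> {..<s}"
  by (auto simp: clique_extension_def grid_graph_def cartesian_product_def complete_graph_def)

text \<open>Without parallel arcs an arc is determined by its ends, so sending it to the pair of
  images of its ends extends \<open>f\<close> to arcs.\<close>

lemma (in graph) digraph_iso_pairI:
  assumes f: "bij_betw f (verts G) (pverts H)"
    and sub: "parcs H \<subseteq> pverts H \<times> pverts H"
    and adj: "\<And>u v. u \<in> verts G \<Longrightarrow> v \<in> verts G \<Longrightarrow> u \<rightarrow>\<^bsub>G\<^esub> v \<longleftrightarrow> (f u, f v) \<in> parcs H"
  shows "digraph_iso G (with_proj H)"
proof -
  define h where "h = \<lparr> iso_verts = f, iso_arcs = (\<lambda>a. (f (tail G a), f (head G a))),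
    iso_head = snd, iso_tail = fst \<rparr>"
  have inj: "inj_on f (verts G)" and img: "f ` verts G = pverts H"
    using f by (auto simp: bij_betw_def)
  have "inj_on (iso_arcs h) (arcs G)"
  proof (rule inj_onI)
    fix a b assume ab: "a \<in> arcs G" "b \<in> arcs G" "iso_arcs h a = iso_arcs h b"
    then have "tail G a = tail G b" "head G a = head G b"
      using inj wellformed by (auto simp: h_def inj_on_def)
    then show "a = b" using no_multi_arcs ab by (auto simp: arc_to_ends_def)
  qed
  then have "digraph_isomorphism h"
    unfolding digraph_isomorphism_def using inj wf_digraph_axioms by (auto simp: h_def)
  moreover have "iso_arcs h ` arcs G = parcs H"
  proof (intro subset_antisym subsetI)
    fix p assume "p \<in> iso_arcs h ` arcs G"
    then obtain a where a: "a \<in> arcs G" "p = (f (tail G a), f (head G a))" by (auto simp: h_def)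
    then show "p \<in> parcs H"
      using adj[of "tail G a" "head G a"] wellformed in_arcs_imp_in_arcs_ends by auto
  next
    fix p assume p: "p \<in> parcs H"
    then obtain u v where uv: "u \<in> verts G" "v \<in> verts G" "p = (f u, f v)"
      using sub img by blast
    then obtain a where "a \<in> arcs G" "tail G a = u" "head G a = v"
      using adj[of u v] p by (auto simp: arcs_ends_conv)
    then show "p \<in> iso_arcs h ` arcs G" using uv by (auto simp: h_def)
  qed
  then have "with_proj H = app_iso h G"
    using img by (simp add: app_iso_def with_proj_def h_def)
  ultimately show ?thesis unfolding digraph_iso_def by blast
qed

lemma (in graph) card_out_neighbours: "card {w. u \<rightarrow>\<^bsub>G\<^esub> w} = out_degree G u"
proof -
  have "{w. u \<rightarrow>\<^bsub>G\<^esub> w} = head G ` out_arcs G u"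
    by (auto simp: arcs_ends_conv out_arcs_def)
  moreover have "inj_on (head G) (out_arcs G u)"
    using no_multi_arcs by (auto simp: inj_on_def out_arcs_def arc_to_ends_def)
  ultimately show ?thesis by (simp add: card_image out_degree_def)
qed

theorem theorem1p1:
  fixes s t :: nat and \<Gamma> :: "('a, 'b) pre_digraph"
  assumes "s \<ge> 2" and "t \<ge> 1"
    and "graph \<Gamma>" and "co_edge_regular \<Gamma>"
    and "graph_spectrum \<Gamma> =
      replicate_mset 1 (of_nat s * (2 * of_nat t + 1) - 1) +
      replicate_mset (2 * t) (of_nat s * of_nat t - 1) +
      replicate_mset ((s - 1) * (t + 1)^2) (- 1) +
      replicate_mset (t^2) (- of_nat s - 1)"
    and "t \<ge> 11 * (s + 1)^3 * (s + 2)"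
  shows "digraph_iso \<Gamma> (with_proj (clique_extension s (with_proj (grid_graph (t + 1)))))"
proof -
  interpret \<Gamma>: graph \<Gamma> by fact
  define N where "N x = {y \<in> verts \<Gamma>. y = x \<or> x \<rightarrow>\<^bsub>\<Gamma>\<^esub> y}" for x
  \<comment> \<open>\<open>N x\<close> contains \<open>x\<close>, so subtracting the identity leaves
    the adjacency matrix.\<close>
  define M where "M x y = (of_bool (y \<in> N x) - of_bool (x = y) :: real)" for x y
  have dom: "x \<in> verts \<Gamma>" "y \<in> verts \<Gamma>" "x \<noteq> y" "y \<rightarrow>\<^bsub>\<Gamma>\<^esub> x" if "x \<rightarrow>\<^bsub>\<Gamma>\<^esub> y" for x y
    using that \<Gamma>.adj_in_verts \<Gamma>.adj_not_same \<Gamma>.graph_symmetric by blast+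
  obtain k \<mu> where k: "\<forall>v\<in>verts \<Gamma>. out_degree \<Gamma> v = k"
    and \<mu>: "\<forall>u\<in>verts \<Gamma>. \<forall>v\<in>verts \<Gamma>. u \<noteq> v \<longrightarrow> \<not> u \<rightarrow>\<^bsub>\<Gamma>\<^esub> v \<longrightarrow> card (common_neighbours \<Gamma> u v) = \<mu>"
    using assms(4) unfolding co_edge_regular_def regular_graph_def by blast
  obtain vs where vs: "distinct vs" "set vs = verts \<Gamma>"
    using finite_distinct_list[OF \<Gamma>.finite_verts] by blast
  define R :: "real multiset" where "R =
      replicate_mset 1 (real s * (2 * real t + 1) - 1) + replicate_mset (2 * t) (real s * real t - 1) +
      replicate_mset ((s - 1) * (t + 1)^2) (- 1) + replicate_mset (t^2) (- real s - 1)"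
  have "function_mat vs M = adjacency_matrix \<Gamma> vs"
    using vs dom(3) by (intro eq_matI)
      (auto simp: function_mat_def adjacency_matrix_def M_def N_def nth_mem[of _ vs])
  then have R: "proots (char_poly (function_mat vs M)) = image_mset of_real R"
    using graph_spectrum_eq[OF vs] assms(5) by (simp add: R_def)
  \<comment> \<open>As \<open>s >= 2\<close>, the cube is at least 27, hence
    \<open>t >= 297 (s + 2)\<close>.\<close>
  have large: "t \<ge> 250" "t \<ge> 13 * s"
  proof -
    have "(s + 1) ^ 3 \<ge> 27" using power_mono[of 3 "s + 1" 3] assms(1) by simp
    then have "27 * (s + 2) \<le> (s + 1) ^ 3 * (s + 2)" by (rule mult_right_mono) simp
    then show "t \<ge> 250" "t \<ge> 13 * s" using assms(1,6) by simp_all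
  qed
  have "grid_spectrum (verts \<Gamma>) N s t"
  \<comment> \<open>The closed neighbourhood has one vertex more than the degree
    \<open>k\<close>.\<close>
  proof (rule grid_spectrum_of_traces[where \<kappa> = "k + 1" and \<mu> = \<mu>])
    show "card (N x) = k + 1" if "x \<in> verts \<Gamma>" for x
    proof -
      have "N x = insert x {y. x \<rightarrow>\<^bsub>\<Gamma>\<^esub> y}" using that dom by (auto simp: N_def)
      moreover have "finite {y. x \<rightarrow>\<^bsub>\<Gamma>\<^esub> y}"
        using dom(2) by (intro finite_subset[OF _ \<Gamma>.finite_verts]) auto
      moreover have "x \<notin> {y. x \<rightarrow>\<^bsub>\<Gamma>\<^esub> y}" using dom(3)[of x x] by blast
      ultimately show ?thesis using k that by (simp add: \<Gamma>.card_out_neighbours)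
    qed
    show "card (N x \<inter> N y) = \<mu>" if "x \<in> verts \<Gamma>" "y \<in> verts \<Gamma>" "y \<notin> N x" for x y
    proof -
      have "N x \<inter> N y = common_neighbours \<Gamma> x y"
        using that dom(4) by (auto simp: N_def common_neighbours_def)
      then show ?thesis using \<mu> that by (auto simp: N_def)
    qed
    show "(\<Sum>x\<in>verts \<Gamma>. shifted_product (verts \<Gamma>) (\<lambda>x y. of_bool (y \<in> N x) - of_bool (x = y)) as x x) =
      (\<Prod>a\<leftarrow>as. real s * (2 * real t + 1) - 1 - a) + 2 * real t * (\<Prod>a\<leftarrow>as. real s * real t - 1 - a) +
      (real s - 1) * (real t + 1)\<^sup>2 * (\<Prod>a\<leftarrow>as. - 1 - a) + (real t)\<^sup>2 * (\<Prod>a\<leftarrow>as. - real s - 1 - a)" for as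
      using trace_shifted_product[OF vs(1) R, of as] assms(1) unfolding vs(2) R_def M_def
      by (simp add: of_nat_diff)
  qed (use \<Gamma>.finite_verts dom assms(1) large in \<open>auto simp: N_def\<close>)
  then obtain f where f: "bij_betw f (verts \<Gamma>) (({..<t + 1} \<times> {..<t + 1}) \<times> {..<s})"
    and adj: "\<And>x y. x \<in> verts \<Gamma> \<Longrightarrow> y \<in> verts \<Gamma> \<Longrightarrow> y \<in> N x \<longleftrightarrow>
      fst (fst (f x)) = fst (fst (f y)) \<or> snd (fst (f x)) = snd (fst (f y))"
    by (rule grid_spectrum.grid_coordinates) blast
  show ?thesis
  proof (rule \<Gamma>.digraph_iso_pairI)
    let ?H = "clique_extension s (with_proj (grid_graph (t + 1)))"
    show "bij_betw f (verts \<Gamma>) (pverts ?H)" unfolding verts_clique_extension_grid by (rule f)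
    show "parcs ?H \<subseteq> pverts ?H \<times> pverts ?H"
      unfolding verts_clique_extension_grid using arcs_clique_extension_grid[of _ _ s "t + 1"] by auto
    fix u v assume uv: "u \<in> verts \<Gamma>" "v \<in> verts \<Gamma>"
    have "f u \<in> ({..<t + 1} \<times> {..<t + 1}) \<times> {..<s}" "f v \<in> ({..<t + 1} \<times> {..<t + 1}) \<times> {..<s}"
      using bij_betwE[OF f] uv by auto
    moreover have "f u = f v \<longleftrightarrow> u = v" using f uv by (auto simp: bij_betw_def inj_on_def)
    moreover have "u \<rightarrow>\<^bsub>\<Gamma>\<^esub> v \<longleftrightarrow> v \<in> N u \<and> u \<noteq> v" using uv dom(3) by (auto simp: N_def)
    ultimately show "u \<rightarrow>\<^bsub>\<Gamma>\<^esub> v \<longleftrightarrow> (f u, f v) \<in> parcs ?H"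
      unfolding arcs_clique_extension_grid using adj[OF uv] by blast
  qed
qed

end
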